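(* Let $K$ be an algebraically closed field, let $d\ge 0$ and $n\ge d+1$ be integers, let $X\subset K^n$ be a $(d+1)$-dimensional linear subspace, equal to the rowspace of a matrix $W\in K^{(d+1)\times n}$, and let $L(X)\subset\mathrm{Gr}(d,n)\subset\mathbb{P}^{\binom{n}{d}-1}$ be the linear subspace of $d$-dimensional linear subspaces contained in $X$. The matroid of $L(X)\subset\mathbb{P}^{\binom{n}{d}-1}$ (a matroid on the ground set $\binom{[n]}{d}$) is a rank-$(d+1)$ matroid that can be described in the following ways: (i) as the matroid of linear dependencies among the columns of the matrix $V\in K^{(d+1)\times\binom{n}{d}}$; (ii) as the dual matroid to the matroid of linear dependencies among the columns of the matrix $U$; (iii) as the matroid of lines of the hyperplane arrangement $\mathcal{A}(X)$ induced by $X$. Here $V$, $U$, $\mathcal A(X)$ and the matroid of lines are as defined in the context.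
   Context: $[n]=\{1,\dots,n\}$ and $\binom{[n]}{m}$ is the set of $m$-element subsets of $[n]$. $\mathrm{Gr}(d,n)$ is the Grassmannian of $d$-dimensional subspaces of $K^n$ in its Plücker embedding (the rowspace of $M\in K^{d\times n}$ has coordinates $\det(M^J)$, $J\in\binom{[n]}{d}$, where $M^J$ is the submatrix with columns $J$). $L(X)$ is the set of points of $\mathrm{Gr}(d,n)$ corresponding to $d$-dimensional subspaces contained in $X$; it is a $d$-dimensional projective linear subspace of $\mathbb{P}^{\binom{n}{d}-1}$. Matroid of a linear subspace: for a linear subspace $L\subset K^E$ ($E$ finite; or its projectivization), the matroid of $L$ is the matroid on $E$ in which the rank of $A\subset E$ is the codimension in $L$ of $L\cap\bigcap_{e\in A}\{x_e=0\}$; equivalently, the matroid of linear dependencies among the columns of any matrix whose rowspace is $L$. The matrix $V$: $V_{i,J}=(-1)^{i+1}\det(W_{-i}^J)$ for $i\in[d+1]$, $J\in\binom{[n]}{d}$, where $W_{-i}^J$ is the submatrix of $W$ with rows $[d+1]\setminus\{i\}$ and columns $J$. The matrix $U$: rows indexed by pairs $(A,B)$ with $A\in\binom{[n]}{d-1}$, $B\in\binom{[n]}{d+2}$, columns indexed by $J\in\binom{[n]}{d}$; $U_{(A,B),J}=(-1)^{|[i]\cap A|+|[i]\cap B|}q_{B\setminus\{i\}}$ if $J=A\cup\{i\}$ for some $i\in B\setminus A$, and $0$ otherwise, where $q_I=\det(W^I)$, $I\in\binom{[n]}{d+1}$, are the Plücker coordinates of $X$. The arrangement $\mathcal A(X)$: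 the arrangement of $n$ hyperplanes in $X\cong K^{d+1}$ obtained by restricting the coordinate hyperplanes $\{x_k=0\}$ of $K^n$ to $X$; it is linearly isomorphic to $\{H_k\}_{k=1}^n$ in $K^{d+1}$ with $H_k=\{x\in K^{d+1}: w_k\cdot x=0\}$, $w_k$ being the $k$-th column of $W$. Matroid of lines: for an arrangement $\{H_k\}_{k=1}^n$ in $K^{d+1}$ and $J\in\binom{[n]}{d}$, let $\ell_J=\bigcap_{k\in J}H_k$ if this intersection has dimension $1$, and $\ell_J=0$ otherwise. The matroid of lines is the matroid on $\binom{[n]}{d}$ in which a collection of $J$'s is independent iff the smallest linear subspace containing the corresponding $\ell_J$'s has dimension equal to the number of elements of the collection. *)

theory Defs
  imports
    "HOL-Library.Function_Algebras"
    "HOL-Computational_Algebra.Polynomial"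
    "Jordan_Normal_Form.Determinant"
begin

datatype 'e matroid = Matroid (ground: "'e set") (indep: "'e set set")

definition is_matroid :: "'e matroid \<Rightarrow> bool" where
  "is_matroid M \<longleftrightarrow>
     finite (ground M) \<and>
     (\<forall>A\<in>indep M. A \<subseteq> ground M) \<and>
     {} \<in> indep M \<and>
     (\<forall>A\<in>indep M. \<forall>B. B \<subseteq> A \<longrightarrow> B \<in> indep M) \<and>
     (\<forall>A\<in>indep M. \<forall>B\<in>indep M. card A < card B \<longrightarrow> (\<exists>x\<in>B - A. insert x A \<in> indep M))"

definition matroid_rank :: "'e matroid \<Rightarrow> 'e set \<Rightarrow> nat" where
  "matroid_rank M A = Max (card ` {B \<in> indep M. B \<subseteq> A})"

definition bases :: "'e matroid \<Rightarrow> 'e set set" where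
  "bases M = {B \<in> indep M. \<forall>A\<in>indep M. B \<subseteq> A \<longrightarrow> A = B}"

text \<open>The bases of the dual matroid are the complements of the bases of \<open>M\<close>.\<close>

definition dual_matroid :: "'e matroid \<Rightarrow> 'e matroid" where
  "dual_matroid M = Matroid (ground M) {A. \<exists>B\<in>bases M. A \<subseteq> ground M - B}"

text \<open>
  For a finite index set \<open>E\<close>, the space \<open>K\<^sup>E\<close> consists of the functions that vanish outside \<open>E\<close>.
  Matrices are functions of a row and a column index; row and column index sets are passed
  separately, and entries outside of them are never used.
\<close>

definition fun_scale :: "'k::field \<Rightarrow> ('e \<Rightarrow> 'k) \<Rightarrow> 'e \<Rightarrow> 'k" where
  "fun_scale c x = (\<lambda>e. c * x e)"

interpretation fun_vs: vector_space "fun_scale :: 'k::field \<Rightarrow> ('e \<Rightarrow> 'k) \<Rightarrow> 'e \<Rightarrow> 'k"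
  by unfold_locales (auto simp: fun_scale_def fun_eq_iff algebra_simps)

definition coord_space :: "'e set \<Rightarrow> ('e \<Rightarrow> 'k::field) set" where
  "coord_space E = {x. \<forall>e. e \<notin> E \<longrightarrow> x e = 0}"

definition mat_row :: "'c set \<Rightarrow> ('r \<Rightarrow> 'c \<Rightarrow> 'k::field) \<Rightarrow> 'r \<Rightarrow> 'c \<Rightarrow> 'k" where
  "mat_row C M r = (\<lambda>c. if c \<in> C then M r c else 0)"

definition mat_col :: "'r set \<Rightarrow> ('r \<Rightarrow> 'c \<Rightarrow> 'k::field) \<Rightarrow> 'c \<Rightarrow> 'r \<Rightarrow> 'k" where
  "mat_col R M c = (\<lambda>r. if r \<in> R then M r c else 0)"

definition rowspace :: "'r set \<Rightarrow> 'c set \<Rightarrow> ('r \<Rightarrow> 'c \<Rightarrow> 'k::field) \<Rightarrow> ('c \<Rightarrow> 'k) set" where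
  "rowspace R C M = fun_vs.span (mat_row C M ` R)"

text \<open>Determinant of the submatrix with rows \<open>R\<close> and columns \<open>C\<close>, both in increasing order.\<close>

definition minor :: "(nat \<Rightarrow> nat \<Rightarrow> 'k::field) \<Rightarrow> nat set \<Rightarrow> nat set \<Rightarrow> 'k" where
  "minor M R C =
     det (mat (card R) (card C)
       (\<lambda>(a, b). M (sorted_list_of_set R ! a) (sorted_list_of_set C ! b)))"

text \<open>
  Columns are treated as an indexed family, so two equal columns are dependent; hence the
  injectivity condition.
\<close>

definition column_matroid :: "'r set \<Rightarrow> 'c set \<Rightarrow> ('r \<Rightarrow> 'c \<Rightarrow> 'k::field) \<Rightarrow> 'c matroid" where
  "column_matroid R C M = Matroid C
     {A. A \<subseteq> C \<and> inj_on (mat_col R M) A \<and> fun_vs.independent (mat_col R M ` A)}"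

definition vanishing_codim :: "('e \<Rightarrow> 'k::field) set \<Rightarrow> 'e set \<Rightarrow> nat" where
  "vanishing_codim L A = fun_vs.dim L - fun_vs.dim (L \<inter> {x. \<forall>e\<in>A. x e = 0})"

text \<open>A matroid is determined by its rank function, so there is at most one such matroid.\<close>

definition matroid_of_subspace :: "'e set \<Rightarrow> ('e \<Rightarrow> 'k::field) set \<Rightarrow> 'e matroid" where
  "matroid_of_subspace E L = (THE M. is_matroid M \<and> ground M = E \<and>
     (\<forall>A. A \<subseteq> E \<longrightarrow> matroid_rank M A = vanishing_codim L A))"

definition subsets :: "nat \<Rightarrow> nat \<Rightarrow> nat set set" where
  "subsets n m = {J. J \<subseteq> {1..n} \<and> card J = m}"

definition plucker :: "nat \<Rightarrow> nat \<Rightarrow> (nat \<Rightarrow> nat \<Rightarrow> 'k::field) \<Rightarrow> nat set \<Rightarrow> 'k" where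
  "plucker d n M = (\<lambda>J. if J \<in> subsets n d then minor M {1..d} J else 0)"

text \<open>
  Points of projective space are lines through the origin.  \<open>grassmannian_point d n S P\<close>: the
  point \<open>P\<close> of the Grassmannian corresponds to the subspace \<open>S\<close>.
\<close>

definition grassmannian_point ::
  "nat \<Rightarrow> nat \<Rightarrow> (nat \<Rightarrow> 'k::field) set \<Rightarrow> (nat set \<Rightarrow> 'k) set \<Rightarrow> bool" where
  "grassmannian_point d n S P \<longleftrightarrow>
     fun_vs.subspace S \<and> S \<subseteq> coord_space {1..n} \<and> fun_vs.dim S = d \<and>
     (\<exists>M. S = rowspace {1..d} {1..n} M \<and> P = fun_vs.span {plucker d n M})"

definition grassmannian_sub ::
  "nat \<Rightarrow> nat \<Rightarrow> (nat \<Rightarrow> 'k::field) set \<Rightarrow> (nat set \<Rightarrow> 'k) set set" where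
  "grassmannian_sub d n X = {P. \<exists>S. S \<subseteq> X \<and> grassmannian_point d n S P}"

definition affine_cone :: "('e \<Rightarrow> 'k::field) set set \<Rightarrow> ('e \<Rightarrow> 'k) set" where
  "affine_cone Ps = insert 0 (\<Union>Ps)"

definition V_mat :: "nat \<Rightarrow> (nat \<Rightarrow> nat \<Rightarrow> 'k::field) \<Rightarrow> nat \<Rightarrow> nat set \<Rightarrow> 'k" where
  "V_mat d W i J = (- 1) ^ (i + 1) * minor W ({1..d + 1} - {i}) J"

text \<open>The condition \<open>card A + 1 = d\<close> leaves no rows when \<open>d = 0\<close>.\<close>

definition U_rows :: "nat \<Rightarrow> nat \<Rightarrow> (nat set \<times> nat set) set" where
  "U_rows d n = {(A, B). A \<subseteq> {1..n} \<and> card A + 1 = d \<and> B \<in> subsets n (d + 2)}"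

definition U_mat ::
  "nat \<Rightarrow> (nat \<Rightarrow> nat \<Rightarrow> 'k::field) \<Rightarrow> nat set \<times> nat set \<Rightarrow> nat set \<Rightarrow> 'k" where
  "U_mat d W = (\<lambda>(A, B) J.
     if \<exists>i\<in>B - A. J = A \<union> {i}
     then let i = (THE i. i \<in> B - A \<and> J = A \<union> {i})
          in (- 1) ^ (card ({1..i} \<inter> A) + card ({1..i} \<inter> B)) * minor W {1..d + 1} (B - {i})
     else 0)"

text \<open>Here \<open>Y\<close> is the ambient vector space and \<open>H k\<close>, \<open>k \<in> {1..n}\<close>, are the members of the
  arrangement.  The member \<open>H k\<close> may be all of \<open>Y\<close>.\<close>

definition arrangement_line ::
  "('e \<Rightarrow> 'k::field) set \<Rightarrow> (nat \<Rightarrow> ('e \<Rightarrow> 'k) set) \<Rightarrow> nat set \<Rightarrow> ('e \<Rightarrow> 'k) set" where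
  "arrangement_line Y H J =
     (if fun_vs.dim (Y \<inter> (\<Inter>k\<in>J. H k)) = 1 then Y \<inter> (\<Inter>k\<in>J. H k) else {0})"

definition matroid_of_lines ::
  "nat \<Rightarrow> nat \<Rightarrow> ('e \<Rightarrow> 'k::field) set \<Rightarrow> (nat \<Rightarrow> ('e \<Rightarrow> 'k) set) \<Rightarrow> nat set matroid" where
  "matroid_of_lines d n Y H = Matroid (subsets n d)
     {A. A \<subseteq> subsets n d \<and> fun_vs.dim (fun_vs.span (\<Union>J\<in>A. arrangement_line Y H J)) = card A}"

definition induced_arrangement :: "(nat \<Rightarrow> 'k::field) set \<Rightarrow> nat \<Rightarrow> (nat \<Rightarrow> 'k) set" where
  "induced_arrangement X k = X \<inter> {x. x k = 0}"

end

theory Submission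
  imports Defs
begin

text \<open>
  The incidence Pluecker relations for \<open>(A, B)\<close> say that all contractions of \<open>p\<close> lie in \<open>X\<close>.
  They hold for the Pluecker vector of every subspace of \<open>X\<close>, in particular for the rows of \<open>V\<close>,
  and if \<open>q\<close> does not vanish at \<open>J\<^sub>0\<close> they determine \<open>p\<close> from its \<open>d + 1\<close> coordinates \<open>p\<^sub>J\<close> with
  \<open>J \<subseteq> J\<^sub>0\<close>.  Hence the kernel of \<open>U\<close> is the rowspace of \<open>V\<close>.  Every vector of this rowspace is
  decomposable, so it is the cone over \<open>L(X)\<close>, which gives (i), and (ii) since matroids of
  orthogonal rowspaces are dual.  For (iii), the linear combination of the rows of \<open>W\<close> with
  coefficients the \<open>J\<close>-th column of \<open>V\<close> has coordinates \<open>0\<close> for \<open>k \<in> J\<close> and \<open>\<plusminus>q\<^bsub>J \<union> k\<^esub>\<close> otherwise, so it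
  spans \<open>\<ell>\<^sub>J\<close>.
\<close>

section \<open>Laplace expansion of minors\<close>

text \<open>No exterior algebra is used: every identity between Pluecker coordinates comes from
  expanding a minor along a new row or column, or along a repeated one, where the result is 0. Signs
  are powers of -1 in the number of smaller indices, so that no positions in sorted lists have to be
  tracked. Two contractions of \<open>W\<close> with \<open>V\<close> carry the argument.
  \<open>sum_mult_V_mat\<close> recovers the coefficients of a combination of the rows of
  \<open>V\<close>, up to the factor \<open>q J0\<close>, from its coordinates at
  \<open>J0 - {j}\<close>. This gives the rank of \<open>V\<close>, the candidate preimage of a
  vector in the kernel of \<open>U\<close>, and the comparison of coefficients in
  \<open>decomposable\<close>. \<open>sum_V_mat_mult\<close> checks that preimage and computes the
  vectors that span the lines. Decomposability is special to codimension one: a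
  \<open>d\<close>-dimensional subspace of \<open>X\<close> is the zero set of one linear form on
  \<open>K^(d+1)\<close>, and its \<open>d + 1\<close> coefficients are those of a combination of
  the \<open>d + 1\<close> rows of \<open>V\<close>. Independence of columns is restated through the
  rowspace alone (\<open>dual_vectors\<close>), which ties it both to codimensions and to relations
  among the columns of \<open>U\<close>.\<close>

lemma sorted_list_of_set_nth_mem:
  fixes S :: "nat set"
  assumes "i < card S"
  shows "sorted_list_of_set S ! i \<in> S"
proof -
  have "finite S" using assms card.infinite by fastforce
  then show ?thesis
    using nth_mem[of i "sorted_list_of_set S"] assms by simp
qed

lemma sorted_list_of_set_nth_exists:
  fixes S :: "nat set"
  assumes "finite S" "a \<in> S"
  obtains i where "i < card S" "sorted_list_of_set S ! i = a"
  using assms in_set_conv_nth[of a "sorted_list_of_set S"] by auto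

text \<open>Converts positions in the sorted list, which give the signs of cofactors, into counts of
  smaller elements, which give the signs from here on.\<close>

lemma card_less_nth:
  fixes S :: "nat set"
  assumes "finite S" "i < card S"
  shows "card {a \<in> S. a < sorted_list_of_set S ! i} = i"
proof -
  let ?s = "sorted_list_of_set S"
  have s: "sorted_wrt (<) ?s" and l: "length ?s = card S" and S: "set ?s = S"
    using assms by auto
  have "{a \<in> S. a < ?s ! i} = (!) ?s ` {..<i}"
  proof (intro equalityI subsetI)
    fix a assume a: "a \<in> {a \<in> S. a < ?s ! i}"
    then obtain j where j: "j < card S" "?s ! j = a"
      using sorted_list_of_set_nth_exists[of S a] assms(1) by auto
    have "\<not> i < j"
      using sorted_wrt_nth_less[OF s, of i j] l j a by auto
    moreover have "i \<noteq> j" using j a by auto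
    ultimately show "a \<in> (!) ?s ` {..<i}" using j by auto
  next
    fix a assume "a \<in> (!) ?s ` {..<i}"
    then obtain j where j: "j < i" "a = ?s ! j" by auto
    then show "a \<in> {a \<in> S. a < ?s ! i}"
      using sorted_wrt_nth_less[OF s, of j i] l assms(2) sorted_list_of_set_nth_mem[of j S] by auto
  qed
  moreover have "inj_on ((!) ?s) {..<i}"
    using assms l by (intro inj_on_nth) auto
  ultimately show ?thesis by (simp add: card_image)
qed

text \<open>Matches the removal of an index from a set with the index shift in
  \<open>mat_delete\<close>.\<close>

lemma sorted_list_of_set_Diff_nth:
  fixes S :: "nat set"
  assumes "finite S" "i < card S" "j < card S - 1"
  shows "sorted_list_of_set (S - {sorted_list_of_set S ! i}) ! j =
    sorted_list_of_set S ! insert_index i j"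
proof -
  let ?s = "sorted_list_of_set S"
  have l: "length ?s = card S" using assms by auto
  have "sorted_list_of_set (S - {?s ! i}) = remove1 (?s ! i) ?s"
    using assms by (simp add: sorted_list_of_set_remove)
  also have "\<dots> = take i ?s @ drop (Suc i) ?s"
  proof -
    have eq: "?s = take i ?s @ ?s ! i # drop (Suc i) ?s"
      using assms l by (simp add: id_take_nth_drop)
    have "?s ! i \<notin> set (take i ?s)"
      using assms l nth_eq_iff_index_eq[OF distinct_sorted_list_of_set[of S]]
      by (auto simp: in_set_conv_nth)
    then have "remove1 (?s ! i) (take i ?s @ ?s ! i # drop (Suc i) ?s) = take i ?s @ drop (Suc i) ?s"
      by (simp add: remove1_append)
    then show ?thesis
      using eq by simp
  qed
  finally show ?thesis
    using assms l by (auto simp: nth_append insert_index_def)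
qed

text \<open>Laplace expansion along the row \<open>k\<close>, whose position in the sorted row set
  is the number of elements of \<open>A\<close> below \<open>k\<close>.\<close>

lemma minor_insert_row:
  fixes M :: "nat \<Rightarrow> nat \<Rightarrow> 'k::field"
  assumes A: "finite A" "k \<notin> A" and B: "finite B" "card B = Suc (card A)"
  shows "minor M (insert k A) B =
    (\<Sum>b\<in>B. (-1) ^ (card {a \<in> A. a < k} + card {b' \<in> B. b' < b}) * M k b * minor M A (B - {b}))"
proof -
  let ?m = "card A" and ?R = "insert k A"
  let ?r = "sorted_list_of_set ?R" and ?c = "sorted_list_of_set B"
  have cR: "card ?R = Suc ?m" "finite ?R" using A by auto
  obtain p where p: "p < Suc ?m" "?r ! p = k"
    using sorted_list_of_set_nth_exists[of ?R k] cR by auto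
  have "card {a \<in> ?R. a < ?r ! p} = p"
    using p cR by (intro card_less_nth) auto
  moreover have "{a \<in> ?R. a < ?r ! p} = {a \<in> A. a < k}"
    using p by auto
  ultimately have p': "card {a \<in> A. a < k} = p" by simp
  define N where "N = mat (Suc ?m) (Suc ?m) (\<lambda>(a, b). M (?r ! a) (?c ! b))"
  have N: "N \<in> carrier_mat (Suc ?m) (Suc ?m)" by (simp add: N_def)
  have minor_del: "minor M A (B - {?c ! j}) = det (mat_delete N p j)" if j: "j < Suc ?m" for j
  proof -
    have jB: "?c ! j \<in> B" using B j by (intro sorted_list_of_set_nth_mem) simp
    have "A = ?R - {?r ! p}" using A p by auto
    then have r: "sorted_list_of_set A ! i = ?r ! insert_index p i" if "i < ?m" for i
      using sorted_list_of_set_Diff_nth[of ?R p i] cR p that by auto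
    have c: "sorted_list_of_set (B - {?c ! j}) ! i = ?c ! insert_index j i" if "i < ?m" for i
      using sorted_list_of_set_Diff_nth[of B j i] B j that by auto
    have cB: "card (B - {?c ! j}) = ?m" using B jB by simp
    show ?thesis
      unfolding minor_def cB mat_delete_def N_def
      by (intro arg_cong[where f = det] eq_matI) (auto simp: r c insert_index_def)
  qed
  have bij: "bij_betw ((!) ?c) {..<Suc ?m} B"
    using B bij_betw_nth[of ?c "{..<Suc ?m}" B] by simp
  have "minor M ?R B = det N"
    unfolding minor_def N_def using cR B by simp
  also have "\<dots> = (\<Sum>j<Suc ?m. N $$ (p, j) * cofactor N p j)"
    by (rule laplace_expansion_row[OF N p(1)])
  also have "\<dots> = (\<Sum>j<Suc ?m. (-1) ^ (p + card {b' \<in> B. b' < ?c ! j}) * M k (?c ! j) * minor M A (B - {?c ! j}))"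
  proof (rule sum.cong[OF refl])
    fix j assume "j \<in> {..<Suc ?m}"
    then have j: "j < Suc ?m" by simp
    then have "card {b' \<in> B. b' < ?c ! j} = j"
      using B by (intro card_less_nth) auto
    then show "N $$ (p, j) * cofactor N p j =
      (-1) ^ (p + card {b' \<in> B. b' < ?c ! j}) * M k (?c ! j) * minor M A (B - {?c ! j})"
      using minor_del[OF j] p j by (simp add: cofactor_def N_def)
  qed
  also have "\<dots> = (\<Sum>b\<in>B. (-1) ^ (p + card {b' \<in> B. b' < b}) * M k b * minor M A (B - {b}))"
    by (rule sum.reindex_bij_betw[OF bij])
  finally show ?thesis unfolding p' .
qed

lemma minor_cong:
  assumes "\<And>r c. r \<in> R \<Longrightarrow> c \<in> C \<Longrightarrow> M r c = N r c"
  shows "minor M R C = minor N R C"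
  unfolding minor_def
  using assms[OF sorted_list_of_set_nth_mem sorted_list_of_set_nth_mem]
  by (intro arg_cong[where f = det] eq_matI) auto

lemma minor_transpose:
  assumes "card R = card C"
  shows "minor (\<lambda>i j. M j i) C R = minor M R C"
proof -
  have "minor M R C = det (transpose_mat (mat (card R) (card R)
      (\<lambda>(a, b). M (sorted_list_of_set R ! a) (sorted_list_of_set C ! b))))"
    unfolding minor_def using assms by (subst det_transpose[of _ "card R"]) auto
  also have "\<dots> = minor (\<lambda>i j. M j i) C R"
    unfolding minor_def using assms by (intro arg_cong[where f = det] eq_matI) auto
  finally show ?thesis by simp
qed

lemma minor_identical_rows:
  fixes M :: "nat \<Rightarrow> nat \<Rightarrow> 'k::field"
  assumes R: "finite R" "r \<in> R" "s \<in> R" "r \<noteq> s" and C: "finite C" "card C = card R"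
    and eq: "\<And>c. c \<in> C \<Longrightarrow> M r c = M s c"
  shows "minor M R C = 0"
proof -
  let ?r = "sorted_list_of_set R" and ?c = "sorted_list_of_set C"
  obtain i j where ij: "i < card R" "j < card R" "?r ! i = r" "?r ! j = s"
    using R sorted_list_of_set_nth_exists[of R] by metis
  have c: "?c ! b \<in> C" if "b < card R" for b
    using that C by (intro sorted_list_of_set_nth_mem) simp
  show ?thesis
    unfolding minor_def
  proof (rule det_identical_rows[of _ "card R" i j])
    show "i \<noteq> j" using ij R by auto
    show "row (mat (card R) (card C) (\<lambda>(a, b). M (?r ! a) (?c ! b))) i =
      row (mat (card R) (card C) (\<lambda>(a, b). M (?r ! a) (?c ! b))) j"
      using ij c eq C by (intro eq_vecI) auto
  qed (use ij C in auto)
qed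

text \<open>Duplicate row \<open>k\<close> under a fresh index and expand along the copy.\<close>

lemma minor_expand_repeated_row:
  fixes M :: "nat \<Rightarrow> nat \<Rightarrow> 'k::field"
  assumes A: "finite A" "k \<in> A" and B: "finite B" "card B = Suc (card A)"
  shows "(\<Sum>b\<in>B. (-1) ^ card {b' \<in> B. b' < b} * M k b * minor M A (B - {b})) = 0"
proof -
  obtain z where z: "z \<notin> A" using A(1) ex_new_if_finite infinite_UNIV_nat by blast
  define N where "N = M(z := M k)"
  have "minor N (insert z A) B = 0"
    using A B z by (intro minor_identical_rows[of _ z k]) (auto simp: N_def)
  moreover have "minor N A (B - {b}) = minor M A (B - {b})" if "b \<in> B" for b
    using A B z that by (intro minor_cong) (auto simp: N_def)
  ultimately have "(\<Sum>b\<in>B. (-1) ^ (card {a \<in> A. a < z} + card {b' \<in> B. b' < b}) * M k b * minor M A (B - {b})) = 0"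
    using minor_insert_row[OF A(1) z B, of N] by (simp add: N_def)
  then have "(-1) ^ card {a \<in> A. a < z} *
      (\<Sum>b\<in>B. (-1) ^ card {b' \<in> B. b' < b} * M k b * minor M A (B - {b})) = 0"
    by (simp add: sum_distrib_left power_add mult.assoc)
  then show ?thesis by simp
qed

lemma minor_insert_column:
  fixes M :: "nat \<Rightarrow> nat \<Rightarrow> 'k::field"
  assumes A: "finite A" "k \<notin> A" and R: "finite R" "card R = Suc (card A)"
  shows "minor M R (insert k A) =
    (\<Sum>r\<in>R. (-1) ^ (card {a \<in> A. a < k} + card {r' \<in> R. r' < r}) * M r k * minor M (R - {r}) A)"
proof -
  have "minor M R (insert k A) = minor (\<lambda>i j. M j i) (insert k A) R"
    using A R by (subst minor_transpose) auto
  also have "\<dots> = (\<Sum>r\<in>R. (-1) ^ (card {a \<in> A. a < k} + card {r' \<in> R. r' < r}) * M r k *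
      minor (\<lambda>i j. M j i) A (R - {r}))"
    by (rule minor_insert_row[OF A R])
  also have "\<dots> = (\<Sum>r\<in>R. (-1) ^ (card {a \<in> A. a < k} + card {r' \<in> R. r' < r}) * M r k *
      minor M (R - {r}) A)"
    using A R by (intro sum.cong refl) (subst minor_transpose, auto)
  finally show ?thesis .
qed

lemma minor_expand_repeated_column:
  fixes M :: "nat \<Rightarrow> nat \<Rightarrow> 'k::field"
  assumes A: "finite A" "k \<in> A" and R: "finite R" "card R = Suc (card A)"
  shows "(\<Sum>r\<in>R. (-1) ^ card {r' \<in> R. r' < r} * M r k * minor M (R - {r}) A) = 0"
proof -
  have "(\<Sum>r\<in>R. (-1) ^ card {r' \<in> R. r' < r} * M r k * minor M (R - {r}) A) =
    (\<Sum>r\<in>R. (-1) ^ card {r' \<in> R. r' < r} * M r k * minor (\<lambda>i j. M j i) A (R - {r}))"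
    using A R by (intro sum.cong refl) (subst minor_transpose, auto)
  also have "\<dots> = 0"
    by (rule minor_expand_repeated_row[OF A R])
  finally show ?thesis .
qed

section \<open>Matroids of matrices\<close>

lemma (in vector_space) span_image_iff:
  assumes "finite I"
  shows "x \<in> span (f ` I) \<longleftrightarrow> (\<exists>c. x = (\<Sum>i\<in>I. scale (c i) (f i)))"
proof
  assume "x \<in> span (f ` I)"
  then show "\<exists>c. x = (\<Sum>i\<in>I. scale (c i) (f i))"
  proof (induction rule: span_induct_alt)
    case base
    have "0 = (\<Sum>i\<in>I. scale 0 (f i))" by simp
    then show ?case by (rule exI[of _ "\<lambda>_. 0"])
  next
    case (step a x y)
    then obtain j c where j: "j \<in> I" "x = f j" and c: "y = (\<Sum>i\<in>I. scale (c i) (f i))" by auto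
    have "scale a x + y = (\<Sum>i\<in>I. scale (if i = j then a else 0) (f i) + scale (c i) (f i))"
      using assms j c by (simp add: sum.distrib if_distrib[of "\<lambda>z. scale z _"] sum.delta cong: if_cong)
    then show ?case
      by (intro exI[of _ "\<lambda>i. (if i = j then a else 0) + c i"]) (simp add: scale_left_distrib)
  qed
next
  assume "\<exists>c. x = (\<Sum>i\<in>I. scale (c i) (f i))"
  then show "x \<in> span (f ` I)"
    by (elim exE, simp only:) (intro span_sum span_scale span_base imageI)
qed

lemma (in vector_space) independent_family_iff:
  assumes "finite I"
  shows "inj_on f I \<and> independent (f ` I) \<longleftrightarrow>
    (\<forall>c. (\<Sum>i\<in>I. scale (c i) (f i)) = 0 \<longrightarrow> (\<forall>i\<in>I. c i = 0))"
proof
  assume f: "inj_on f I \<and> independent (f ` I)"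
  show "\<forall>c. (\<Sum>i\<in>I. scale (c i) (f i)) = 0 \<longrightarrow> (\<forall>i\<in>I. c i = 0)"
  proof (intro allI impI ballI)
    fix c i assume c: "(\<Sum>i\<in>I. scale (c i) (f i)) = 0" and i: "i \<in> I"
    have "(\<Sum>v\<in>f ` I. scale (c (the_inv_into I f v)) v) = 0"
      using f c by (subst sum.reindex) (auto simp: the_inv_into_f_f cong: sum.cong)
    then have "c (the_inv_into I f (f i)) = 0"
      using f assms i by (intro independentD[of "f ` I"]) auto
    then show "c i = 0" using f i by (simp add: the_inv_into_f_f)
  qed
next
  assume f: "\<forall>c. (\<Sum>i\<in>I. scale (c i) (f i)) = 0 \<longrightarrow> (\<forall>i\<in>I. c i = 0)"
  have inj: "inj_on f I"
  proof (rule inj_onI, rule ccontr)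
    fix i j assume ij: "i \<in> I" "j \<in> I" "f i = f j" "i \<noteq> j"
    have "(\<Sum>l\<in>I. scale ((if l = i then 1 else 0) - (if l = j then 1 else 0)) (f l)) = 0"
      using ij assms by (simp add: scale_left_diff_distrib sum_subtractf
        if_distrib[of "\<lambda>z. scale z _"] sum.delta cong: if_cong)
    then show False using f[rule_format, of "\<lambda>l. (if l = i then 1 else 0) - (if l = j then 1 else 0)" i] ij
      by simp
  qed
  moreover have "independent (f ` I)"
  proof (rule independent_if_scalars_zero)
    fix u v assume u: "(\<Sum>v\<in>f ` I. scale (u v) v) = 0" and v: "v \<in> f ` I"
    have "(\<Sum>i\<in>I. scale (u (f i)) (f i)) = 0"
      using u inj by (simp add: sum.reindex)
    then have "\<forall>i\<in>I. u (f i) = 0" using f[THEN spec, of "\<lambda>i. u (f i)"] by blast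
    then show "u v = 0" using v by blast
  qed (use assms in simp)
  ultimately show "inj_on f I \<and> independent (f ` I)" by simp
qed

lemma sum_fun_apply: "(\<Sum>i\<in>I. f i) x = (\<Sum>i\<in>I. f i x)" for f :: "'i \<Rightarrow> 'e \<Rightarrow> 'k::comm_monoid_add"
  by (induction I rule: infinite_finite_induct) auto

lemma rowspace_iff:
  assumes "finite R"
  shows "x \<in> rowspace R C M \<longleftrightarrow> (\<exists>c. x = (\<lambda>j. if j \<in> C then \<Sum>r\<in>R. c r * M r j else 0))"
proof -
  have "(\<Sum>r\<in>R. fun_scale (c r) (mat_row C M r)) = (\<lambda>j. if j \<in> C then \<Sum>r\<in>R. c r * M r j else 0)" for c
    by (auto simp: fun_eq_iff sum_fun_apply fun_scale_def mat_row_def)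
  then show ?thesis
    unfolding rowspace_def fun_vs.span_image_iff[OF assms] by simp
qed

lemma rowspace_subset_coord_space: "rowspace R C M \<subseteq> coord_space C"
  unfolding rowspace_def
  by (rule fun_vs.span_minimal)
    (auto simp: fun_vs.subspace_def coord_space_def mat_row_def fun_scale_def)

lemma subspace_rowspace: "fun_vs.subspace (rowspace R C M)"
  by (simp add: rowspace_def)

text \<open>The coordinate functionals indexed by \<open>A\<close>, restricted to \<open>L\<close>,
  have a dual family in \<open>L\<close>. This expresses independence of columns without reference
  to a matrix.\<close>

definition dual_vectors :: "('e \<Rightarrow> 'k::field) set \<Rightarrow> 'e set \<Rightarrow> bool" where
  "dual_vectors L A \<longleftrightarrow> (\<forall>a\<in>A. \<exists>x\<in>L. x a = 1 \<and> (\<forall>b\<in>A - {a}. x b = 0))"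

lemma columns_independent_iff:
  fixes M :: "'r \<Rightarrow> 'c \<Rightarrow> 'k::field"
  assumes "finite A"
  shows "inj_on (mat_col R M) A \<and> fun_vs.independent (mat_col R M ` A) \<longleftrightarrow>
    (\<forall>c. (\<forall>r\<in>R. (\<Sum>a\<in>A. c a * M r a) = 0) \<longrightarrow> (\<forall>a\<in>A. c a = 0))"
proof -
  have "(\<Sum>a\<in>A. fun_scale (c a) (mat_col R M a)) = (\<lambda>r. if r \<in> R then \<Sum>a\<in>A. c a * M r a else 0)" for c
    by (auto simp: fun_eq_iff sum_fun_apply fun_scale_def mat_col_def)
  then have "(\<Sum>a\<in>A. fun_scale (c a) (mat_col R M a)) = 0 \<longleftrightarrow> (\<forall>r\<in>R. (\<Sum>a\<in>A. c a * M r a) = 0)" for c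
    by (auto simp: fun_eq_iff)
  then show ?thesis
    unfolding fun_vs.independent_family_iff[OF assms] by simp
qed

text \<open>The dual vectors are values of the coordinate functionals of a basis of \<open>K\<^sup>R\<close> that extends
  the columns indexed by \<open>A\<close>.\<close>

lemma columns_independent_iff_dual_vectors:
  fixes M :: "'r \<Rightarrow> 'c \<Rightarrow> 'k::field"
  assumes "finite R" "finite A" "A \<subseteq> C"
  shows "inj_on (mat_col R M) A \<and> fun_vs.independent (mat_col R M ` A) \<longleftrightarrow>
    dual_vectors (rowspace R C M) A"
proof
  assume A: "inj_on (mat_col R M) A \<and> fun_vs.independent (mat_col R M ` A)"
  show "dual_vectors (rowspace R C M) A"
    unfolding dual_vectors_def
  proof
    fix a assume a: "a \<in> A"
    define D where "D = fun_vs.extend_basis (mat_col R M ` A)"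
    have D: "fun_vs.independent D" "fun_vs.span D = UNIV" "mat_col R M ` A \<subseteq> D"
      using A fun_vs.independent_extend_basis fun_vs.extend_basis_superset
      by (auto simp: D_def)
    define f where "f v = fun_vs.representation D v (mat_col R M a)" for v
    define e :: "'r \<Rightarrow> 'r \<Rightarrow> 'k" where "e r = (\<lambda>s. if s = r then 1 else 0)" for r
    have f_col: "f (mat_col R M b) = (\<Sum>r\<in>R. f (e r) * M r b)" for b
    proof -
      have "mat_col R M b = (\<Sum>r\<in>R. fun_scale (M r b) (e r))"
        using assms(1) by (auto simp: fun_eq_iff sum_fun_apply fun_scale_def mat_col_def e_def sum.delta
            if_distrib[of "\<lambda>z. _ * z"] cong: if_cong)
      then show ?thesis
        unfolding f_def
        by (simp add: fun_vs.representation_sum fun_vs.representation_scale D mult.commute)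
    qed
    have f: "f (mat_col R M b) = (if mat_col R M b = mat_col R M a then 1 else 0)" if "b \<in> A" for b
      using D that by (auto simp: f_def fun_vs.representation_basis)
    define x where "x = (\<lambda>j. if j \<in> C then \<Sum>r\<in>R. f (e r) * M r j else 0)"
    have "x \<in> rowspace R C M"
      unfolding rowspace_iff[OF assms(1)] x_def by (rule exI[of _ "\<lambda>r. f (e r)"], rule refl)
    moreover have "x b = (if b = a then 1 else 0)" if "b \<in> A" for b
    proof -
      have "x b = f (mat_col R M b)" unfolding f_col using that assms(3) by (auto simp: x_def)
      moreover have "mat_col R M b = mat_col R M a \<longleftrightarrow> b = a"
        using A that a by (meson inj_on_eq_iff)
      ultimately show ?thesis using f[OF that] by simp
    qed
    ultimately show "\<exists>x\<in>rowspace R C M. x a = 1 \<and> (\<forall>b\<in>A - {a}. x b = 0)"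
      using a by (intro bexI[of _ x]) auto
  qed
next
  assume A: "dual_vectors (rowspace R C M) A"
  show "inj_on (mat_col R M) A \<and> fun_vs.independent (mat_col R M ` A)"
    unfolding columns_independent_iff[OF assms(2)]
  proof (intro allI impI ballI)
    fix c a assume c: "\<forall>r\<in>R. (\<Sum>a\<in>A. c a * M r a) = 0" and a: "a \<in> A"
    obtain x where x: "x \<in> rowspace R C M" "x a = 1" "\<forall>b\<in>A - {a}. x b = 0"
      using A a unfolding dual_vectors_def by blast
    then obtain u where u: "x = (\<lambda>j. if j \<in> C then \<Sum>r\<in>R. u r * M r j else 0)"
      unfolding rowspace_iff[OF assms(1)] by blast
    \<comment> \<open>Pairing the relation \<open>c\<close> with \<open>x\<close> isolates
      \<open>c a\<close>. As \<open>x\<close> combines rows of \<open>M\<close>, the pairing is also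
      a combination of the vanishing row sums.\<close>
    have "c a = (\<Sum>b\<in>A. if b = a then c b else 0)"
      using a assms(2) by simp
    also have "\<dots> = (\<Sum>b\<in>A. c b * x b)"
      using x by (intro sum.cong) auto
    also have "\<dots> = (\<Sum>b\<in>A. \<Sum>r\<in>R. u r * (c b * M r b))"
      using assms(3) by (intro sum.cong) (auto simp: u sum_distrib_left algebra_simps)
    also have "\<dots> = (\<Sum>r\<in>R. u r * (\<Sum>b\<in>A. c b * M r b))"
      by (subst sum.swap) (simp add: sum_distrib_left)
    also have "\<dots> = 0" using c by simp
    finally show "c a = 0" .
  qed
qed

lemma column_matroid_simps [simp]:
  "ground (column_matroid R C M) = C"
  "A \<in> indep (column_matroid R C M) \<longleftrightarrow>
    A \<subseteq> C \<and> inj_on (mat_col R M) A \<and> fun_vs.independent (mat_col R M ` A)"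
  by (auto simp: column_matroid_def)

lemma column_matroid_insert:
  assumes "A \<in> indep (column_matroid R C M)" "x \<in> C" "mat_col R M x \<notin> fun_vs.span (mat_col R M ` A)"
  shows "insert x A \<in> indep (column_matroid R C M)"
  using assms fun_vs.span_base[of "mat_col R M x" "mat_col R M ` A"]
    fun_vs.independent_insertI[of "mat_col R M x" "mat_col R M ` A"]
  by auto

lemma column_in_span:
  assumes "A \<in> indep (column_matroid R C M)" "x \<in> C"
    "x \<notin> A \<Longrightarrow> insert x A \<notin> indep (column_matroid R C M)"
  shows "mat_col R M x \<in> fun_vs.span (mat_col R M ` A)"
proof (cases "x \<in> A")
  case True
  then show ?thesis by (intro fun_vs.span_base imageI)
next
  case False
  then show ?thesis using column_matroid_insert[OF assms(1,2)] assms(3) by blast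
qed

text \<open>Augmentation is the Steinitz bound: if no element of \<open>B\<close> could be added to
  \<open>A\<close>, the independent columns of \<open>B\<close> would lie in the span of fewer
  columns.\<close>

lemma is_matroid_column_matroid:
  assumes "finite C"
  shows "is_matroid (column_matroid R C M)"
  unfolding is_matroid_def
proof (intro conjI ballI allI impI)
  fix A B assume A: "A \<in> indep (column_matroid R C M)" and B: "B \<in> indep (column_matroid R C M)"
    and lt: "card A < card B"
  have fin: "finite A" "finite B" using A B assms by (auto intro: finite_subset)
  show "\<exists>x\<in>B - A. insert x A \<in> indep (column_matroid R C M)"
  proof (rule ccontr)
    assume neg: "\<not> ?thesis"
    have "mat_col R M x \<in> fun_vs.span (mat_col R M ` A)" if "x \<in> B" for x
    proof (rule column_in_span[OF A])
      show "x \<in> C" using B that by auto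
      show "insert x A \<notin> indep (column_matroid R C M)" if "x \<notin> A"
        using neg that \<open>x \<in> B\<close> by blast
    qed
    then have "card (mat_col R M ` B) \<le> card (mat_col R M ` A)"
      using B fin fun_vs.independent_span_bound[of "mat_col R M ` A" "mat_col R M ` B"] by auto
    then show False using lt A B by (simp add: card_image)
  qed
next
  fix A B assume "A \<in> indep (column_matroid R C M)" "B \<subseteq> A"
  then show "B \<in> indep (column_matroid R C M)"
    using fun_vs.independent_mono[of "mat_col R M ` A" "mat_col R M ` B"] inj_on_subset[of "mat_col R M" A B]
    by auto
qed (use assms fun_vs.independent_empty in auto)

section \<open>Rank in abstract matroids\<close>

lemma matroid_exchange:
  assumes "is_matroid M" "A \<in> indep M" "B \<in> indep M" "card A < card B"
  obtains x where "x \<in> B - A" "insert x A \<in> indep M"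
  using assms unfolding is_matroid_def by blast

text \<open>By exchange, a larger independent subset of \<open>A\<close> would supply an element
  that extends \<open>B\<close> inside \<open>A\<close>.\<close>

lemma matroid_rank_eq_card:
  assumes M: "is_matroid M" and B: "B \<in> indep M" "B \<subseteq> A" "\<And>x. x \<in> A - B \<Longrightarrow> insert x B \<notin> indep M"
  shows "matroid_rank M A = card B"
  unfolding matroid_rank_def
proof (rule Max_eqI)
  have "indep M \<subseteq> Pow (ground M)" "finite (ground M)" using M by (auto simp: is_matroid_def)
  then have "finite (indep M)" by (meson finite_Pow_iff finite_subset)
  then show "finite (card ` {B \<in> indep M. B \<subseteq> A})" by simp
  show "card B \<in> card ` {B \<in> indep M. B \<subseteq> A}" using B by blast
  fix y assume "y \<in> card ` {B \<in> indep M. B \<subseteq> A}"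
  then obtain D where D: "D \<in> indep M" "D \<subseteq> A" "y = card D" by blast
  show "y \<le> card B"
  proof (rule ccontr)
    assume "\<not> y \<le> card B"
    then obtain x where "x \<in> D - B" "insert x B \<in> indep M"
      using matroid_exchange[OF M B(1) D(1)] D(3) by auto
    then show False using B D by blast
  qed
qed

lemma matroid_maximal_independent:
  assumes M: "is_matroid M"
  obtains B where "B \<in> indep M" "B \<subseteq> A" "\<And>x. x \<in> A - B \<Longrightarrow> insert x B \<notin> indep M"
proof -
  have "indep M \<subseteq> Pow (ground M)" "finite (ground M)" using M by (auto simp: is_matroid_def)
  then have "finite (indep M)" by (meson finite_Pow_iff finite_subset)
  then have "finite {B \<in> indep M. B \<subseteq> A}" by simp
  moreover have "{} \<in> {B \<in> indep M. B \<subseteq> A}" using M by (auto simp: is_matroid_def)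
  ultimately obtain B where B: "B \<in> {B \<in> indep M. B \<subseteq> A}"
    "\<forall>D\<in>{B \<in> indep M. B \<subseteq> A}. B \<subseteq> D \<longrightarrow> B = D"
    using finite_has_maximal[of "{B \<in> indep M. B \<subseteq> A}"] by blast
  show ?thesis
  proof (rule that[of B])
    fix x assume "x \<in> A - B"
    then show "insert x B \<notin> indep M" using B by blast
  qed (use B in auto)
qed

lemma matroid_independent_iff_rank:
  assumes M: "is_matroid M"
  shows "A \<in> indep M \<longleftrightarrow> A \<subseteq> ground M \<and> matroid_rank M A = card A"
proof
  assume A: "A \<in> indep M"
  show "A \<subseteq> ground M \<and> matroid_rank M A = card A"
  proof
    show "A \<subseteq> ground M" using M A unfolding is_matroid_def by blast
    show "matroid_rank M A = card A" by (rule matroid_rank_eq_card[OF M A]) auto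
  qed
next
  assume A: "A \<subseteq> ground M \<and> matroid_rank M A = card A"
  obtain B where B: "B \<in> indep M" "B \<subseteq> A" "\<And>x. x \<in> A - B \<Longrightarrow> insert x B \<notin> indep M"
    using matroid_maximal_independent[OF M] by blast
  have "finite A" using A M finite_subset by (auto simp: is_matroid_def)
  moreover have "card B = card A" using matroid_rank_eq_card[OF M B] A by simp
  ultimately show "A \<in> indep M" using B card_subset_eq by blast
qed

text \<open>Gives the uniqueness behind the definite description in
  \<open>matroid_of_subspace\<close>.\<close>

lemma matroid_eqI:
  assumes "is_matroid M" "is_matroid N" "ground M = ground N"
    "\<And>A. A \<subseteq> ground M \<Longrightarrow> matroid_rank M A = matroid_rank N A"
  shows "M = N"
proof -
  have "A \<in> indep M \<longleftrightarrow> A \<in> indep N" for A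
    unfolding matroid_independent_iff_rank[OF assms(1)] matroid_independent_iff_rank[OF assms(2)]
    using assms(3,4) by auto
  then have "indep M = indep N" by blast
  then show ?thesis using assms(3) by (simp add: matroid.expand)
qed

section \<open>Codimension and duality for rowspaces\<close>

lemma dim_hyperplane_section:
  fixes L :: "('e \<Rightarrow> 'k::field) set"
  assumes L: "fun_vs.subspace L" "finite F" "L \<subseteq> fun_vs.span F" and x: "x \<in> L" "x b = 1"
  shows "fun_vs.dim L = Suc (fun_vs.dim (L \<inter> {y. y b = 0}))"
proof -
  obtain D where D: "D \<subseteq> L \<inter> {y. y b = 0}" "fun_vs.independent D" "L \<inter> {y. y b = 0} \<subseteq> fun_vs.span D"
      "card D = fun_vs.dim (L \<inter> {y. y b = 0})"
    using fun_vs.basis_exists by blast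
  have "finite D"
    using fun_vs.independent_span_bound[OF L(2) D(2)] D(1) L(3) by auto
  have "fun_vs.span D \<subseteq> {y. y b = 0}"
    using D(1) by (intro fun_vs.span_minimal) (auto simp: fun_vs.subspace_def fun_scale_def)
  then have x_D: "x \<notin> fun_vs.span D" using x by auto
  show ?thesis
  proof (rule fun_vs.dim_unique[of "insert x D"])
    show "insert x D \<subseteq> L" using x D by blast
    show "L \<subseteq> fun_vs.span (insert x D)"
    proof
      fix y assume y: "y \<in> L"
      have "y - fun_scale (y b) x \<in> L \<inter> {y. y b = 0}"
        using fun_vs.subspace_diff[OF L(1) y fun_vs.subspace_scale[OF L(1) x(1)], of "y b"] x(2)
        by (simp add: fun_scale_def)
      then show "y \<in> fun_vs.span (insert x D)"
        unfolding fun_vs.span_breakdown_eq using D(3) by blast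
    qed
    show "fun_vs.independent (insert x D)"
      using x_D D(2) by (rule fun_vs.independent_insertI)
    show "card (insert x D) = Suc (fun_vs.dim (L \<inter> {y. y b = 0}))"
    proof -
      have "x \<notin> D" using x_D fun_vs.span_base by blast
      then show ?thesis using \<open>finite D\<close> D(4) by simp
    qed
  qed
qed

text \<open>Each equation \<open>x b = 0\<close>, imposed after the others, lowers the dimension by
  exactly one, because the dual vector of \<open>b\<close> satisfies the earlier equations but not
  this one.\<close>

lemma vanishing_codim_dual_vectors:
  fixes L :: "('e \<Rightarrow> 'k::field) set"
  assumes L: "fun_vs.subspace L" "finite F" "L \<subseteq> fun_vs.span F" and "finite B" "dual_vectors L B"
  shows "vanishing_codim L B = card B"
proof -
  have "fun_vs.dim L = fun_vs.dim (L \<inter> {x. \<forall>e\<in>B. x e = 0}) + card B"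
    using assms(4,5)
  proof (induction B)
    case empty
    then show ?case by simp
  next
    case (insert b B)
    have "dual_vectors L B"
      using insert.prems unfolding dual_vectors_def by blast
    moreover obtain x where "x \<in> L" "x b = 1" "\<forall>c\<in>B. x c = 0"
      using insert.prems insert.hyps unfolding dual_vectors_def by (metis Diff_insert_absorb insertI1)
    moreover have "fun_vs.subspace (L \<inter> {x. \<forall>e\<in>B. x e = 0})"
      using L(1) by (auto simp: fun_vs.subspace_def fun_scale_def)
    moreover have "L \<inter> {x. \<forall>e\<in>B. x e = 0} \<inter> {y. y b = 0} = L \<inter> {x. \<forall>e\<in>insert b B. x e = 0}"
      by auto
    moreover have "L \<inter> {x. \<forall>e\<in>B. x e = 0} \<subseteq> fun_vs.span F"
      using L(3) by blast
    ultimately show ?case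
      using dim_hyperplane_section[of "L \<inter> {x. \<forall>e\<in>B. x e = 0}" F x b, OF _ L(2)] insert.IH insert.hyps
      by auto
  qed
  then show ?thesis by (simp add: vanishing_codim_def)
qed

text \<open>A linear relation among columns is a relation among the coordinates of every vector in
  the rowspace. Hence vanishing on a maximal independent subset \<open>B\<close> of \<open>A\<close>
  forces vanishing on \<open>A\<close>, and the codimension can be computed for
  \<open>B\<close>.\<close>

lemma matroid_of_subspace_rowspace:
  fixes M :: "'r \<Rightarrow> 'e \<Rightarrow> 'k::field"
  assumes R: "finite R" and E: "finite E"
  shows "matroid_of_subspace E (rowspace R E M) = column_matroid R E M" (is ?thesis1)
    and "A \<subseteq> E \<Longrightarrow> matroid_rank (column_matroid R E M) A = vanishing_codim (rowspace R E M) A"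
proof -
  let ?N = "column_matroid R E M" and ?L = "rowspace R E M"
  have N: "is_matroid ?N" by (rule is_matroid_column_matroid[OF E])
  show rank: "matroid_rank ?N A = vanishing_codim ?L A" if A: "A \<subseteq> E" for A
  proof -
    obtain B where B: "B \<in> indep ?N" "B \<subseteq> A" "\<And>x. x \<in> A - B \<Longrightarrow> insert x B \<notin> indep ?N"
      using matroid_maximal_independent[OF N] by blast
    have fB: "finite B" using A B E by (meson finite_subset)
    have col: "mat_col R M a \<in> fun_vs.span (mat_col R M ` B)" if "a \<in> A" for a
      by (rule column_in_span[OF B(1)]) (use B(3) that A in blast)+
    have "x a = 0" if x: "x \<in> ?L" "\<forall>b\<in>B. x b = 0" and a: "a \<in> A" for x a
    proof -
      obtain c where c: "mat_col R M a = (\<Sum>b\<in>B. fun_scale (c b) (mat_col R M b))"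
        using col[OF a] fun_vs.span_image_iff[OF fB] by blast
      have c': "M r a = (\<Sum>b\<in>B. c b * M r b)" if "r \<in> R" for r
        using fun_cong[OF c, of r] that by (simp add: mat_col_def sum_fun_apply fun_scale_def)
      obtain u where u: "x = (\<lambda>j. if j \<in> E then \<Sum>r\<in>R. u r * M r j else 0)"
        using x unfolding rowspace_iff[OF R] by blast
      have "x a = (\<Sum>r\<in>R. u r * (\<Sum>b\<in>B. c b * M r b))"
        using a A c' by (auto simp: u)
      also have "\<dots> = (\<Sum>b\<in>B. c b * (\<Sum>r\<in>R. u r * M r b))"
        by (simp add: sum_distrib_left sum.swap[of _ B] mult.left_commute)
      also have "\<dots> = (\<Sum>b\<in>B. c b * x b)"
        using A B by (intro sum.cong) (auto simp: u)
      also have "\<dots> = 0" using x by simp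
      finally show ?thesis .
    qed
    then have "?L \<inter> {x. \<forall>e\<in>A. x e = 0} = ?L \<inter> {x. \<forall>e\<in>B. x e = 0}"
      using B(2) by auto
    then have "vanishing_codim ?L A = vanishing_codim ?L B" by (simp add: vanishing_codim_def)
    also have "\<dots> = card B"
    proof (rule vanishing_codim_dual_vectors[OF subspace_rowspace _ _ fB])
      show "finite (mat_row E M ` R)" using R by simp
      show "?L \<subseteq> fun_vs.span (mat_row E M ` R)" by (simp add: rowspace_def)
      show "dual_vectors ?L B"
        using B(1) columns_independent_iff_dual_vectors[OF R fB, of E M] by auto
    qed
    also have "\<dots> = matroid_rank ?N A"
      by (rule matroid_rank_eq_card[OF N B, symmetric])
    finally show ?thesis ..
  qed
  show ?thesis1
    unfolding matroid_of_subspace_def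
  proof (rule the_equality)
    show "is_matroid ?N \<and> ground ?N = E \<and> (\<forall>A\<subseteq>E. matroid_rank ?N A = vanishing_codim ?L A)"
      using N rank by auto
    fix N' assume "is_matroid N' \<and> ground N' = E \<and> (\<forall>A\<subseteq>E. matroid_rank N' A = vanishing_codim ?L A)"
    then show "N' = ?N" using N rank by (intro matroid_eqI) auto
  qed
qed

text \<open>By \<open>ker\<close>, the rowspace of \<open>V\<close> consists of the relations among
  the columns of \<open>U\<close>. A dual vector for \<open>a\<close> is then a relation that
  expresses column \<open>a\<close> of \<open>U\<close> through columns outside \<open>A\<close>. So
  \<open>A\<close> is independent for \<open>V\<close> iff the columns of \<open>U\<close> outside
  \<open>A\<close> span all of them, that is, iff the complement of \<open>A\<close> contains a
  base.\<close>

lemma dual_column_matroid: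
  fixes V :: "'r \<Rightarrow> 'e \<Rightarrow> 'k::field" and U :: "'s \<Rightarrow> 'e \<Rightarrow> 'k"
  assumes R: "finite R" and E: "finite E"
    and ker: "\<And>x. x \<in> coord_space E \<Longrightarrow>
      x \<in> rowspace R E V \<longleftrightarrow> (\<forall>s\<in>S. (\<Sum>e\<in>E. U s e * x e) = 0)"
  shows "column_matroid R E V = dual_matroid (column_matroid S E U)"
proof -
  let ?N = "column_matroid S E U" and ?u = "mat_col S U"
  have N: "is_matroid ?N" by (rule is_matroid_column_matroid[OF E])
  have relation: "x \<in> rowspace R E V \<longleftrightarrow> (\<Sum>e\<in>E. fun_scale (x e) (?u e)) = 0" if "x \<in> coord_space E" for x
  proof -
    have "(\<Sum>e\<in>E. fun_scale (x e) (?u e)) = (\<lambda>s. if s \<in> S then \<Sum>e\<in>E. x e * U s e else 0)"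
      by (auto simp: fun_eq_iff sum_fun_apply fun_scale_def mat_col_def)
    then show ?thesis
      unfolding ker[OF that] by (auto simp: fun_eq_iff mult.commute)
  qed
  have "A \<in> indep (column_matroid R E V) \<longleftrightarrow> (\<exists>B\<in>bases ?N. A \<subseteq> E - B)" for A
  proof
    assume A: "A \<in> indep (column_matroid R E V)"
    then have AE: "A \<subseteq> E" "finite A" using E by (auto intro: finite_subset)
    have dual: "dual_vectors (rowspace R E V) A"
      using A columns_independent_iff_dual_vectors[OF R AE(2,1)] by auto
    \<comment> \<open>Maximal only outside \<open>A\<close>; the dual vectors show that the columns
      in \<open>A\<close> lie in the same span, which makes \<open>B\<close> a base.\<close>
    obtain B where B: "B \<in> indep ?N" "B \<subseteq> E - A" "\<And>x. x \<in> E - A - B \<Longrightarrow> insert x B \<notin> indep ?N"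
      using matroid_maximal_independent[OF N] by blast
    have col: "?u e \<in> fun_vs.span (?u ` B)" if "e \<in> E - A" for e
      by (rule column_in_span[OF B(1)]) (use B(3) that in blast)+
    have col_A: "?u a \<in> fun_vs.span (?u ` B)" if a: "a \<in> A" for a
    proof -
      obtain x where x: "x \<in> rowspace R E V" "x a = 1" "\<forall>b\<in>A - {a}. x b = 0"
        using dual a unfolding dual_vectors_def by blast
      have "0 = (\<Sum>e\<in>E. fun_scale (x e) (?u e))"
        using relation x(1) rowspace_subset_coord_space[of R E V] by (metis subsetD)
      also have "\<dots> = ?u a + (\<Sum>e\<in>E - {a}. fun_scale (x e) (?u e))"
        using a AE E x(2) by (subst sum.remove[of _ a]) auto
      finally have "?u a = - (\<Sum>e\<in>E - {a}. fun_scale (x e) (?u e))"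
        by (metis eq_neg_iff_add_eq_0)
      moreover have "(\<Sum>e\<in>E - {a}. fun_scale (x e) (?u e)) \<in> fun_vs.span (?u ` B)"
      proof (rule fun_vs.span_sum)
        fix e assume "e \<in> E - {a}"
        then show "fun_scale (x e) (?u e) \<in> fun_vs.span (?u ` B)"
          using x(3) col[of e] fun_vs.span_zero by (cases "e \<in> A") (auto intro: fun_vs.span_scale)
      qed
      ultimately show ?thesis by (simp add: fun_vs.span_neg)
    qed
    have "D = B" if D: "D \<in> indep ?N" "B \<subseteq> D" for D
    proof (rule ccontr)
      assume "D \<noteq> B"
      then obtain e where e: "e \<in> D" "e \<notin> B" using D by blast
      have "?u e \<in> fun_vs.span (?u ` B)"
        using col col_A e(1) D(1) by auto
      moreover have "?u ` B \<subseteq> ?u ` D - {?u e}"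
        using D e by (auto simp: inj_on_def)
      ultimately have "?u e \<in> fun_vs.span (?u ` D - {?u e})"
        using fun_vs.span_mono by blast
      then show False using D e by (auto simp: fun_vs.dependent_def)
    qed
    then have "B \<in> bases ?N" using B(1) by (auto simp: bases_def)
    then show "\<exists>B\<in>bases ?N. A \<subseteq> E - B" using B AE by blast
  next
    assume "\<exists>B\<in>bases ?N. A \<subseteq> E - B"
    then obtain B where B: "B \<in> bases ?N" "A \<subseteq> E - B" by blast
    have BN: "B \<in> indep ?N" and BE: "B \<subseteq> E" using B by (auto simp: bases_def)
    have fin: "finite A" "finite B" "A \<subseteq> E" using E B BE by (auto intro: finite_subset)
    have "dual_vectors (rowspace R E V) A"
      unfolding dual_vectors_def
    proof
      fix a assume a: "a \<in> A"
      have "insert a B \<notin> indep ?N"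
        using B a unfolding bases_def by blast
      then have "?u a \<in> fun_vs.span (?u ` B)"
        using a fin by (intro column_in_span[OF BN]) auto
      then obtain c where c: "?u a = (\<Sum>b\<in>B. fun_scale (c b) (?u b))"
        using fun_vs.span_image_iff[OF fin(2)] by blast
      \<comment> \<open>The relation of the fundamental circuit of \<open>a\<close> with respect to
        the base \<open>B\<close>; it vanishes on the rest of \<open>A\<close> because
        \<open>A\<close> and \<open>B\<close> are disjoint.\<close>
      define x where "x e = (if e = a then 1 else if e \<in> B then - c e else 0)" for e
      have aB: "a \<notin> B" "a \<in> E" using a B by auto
      have "x \<in> coord_space E" using aB BE by (auto simp: x_def coord_space_def)
      moreover have "(\<Sum>e\<in>E. fun_scale (x e) (?u e)) = (\<Sum>e\<in>insert a B. fun_scale (x e) (?u e))"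
        using aB BE E by (intro sum.mono_neutral_right) (auto simp: x_def)
      moreover have "(\<Sum>e\<in>insert a B. fun_scale (x e) (?u e)) = ?u a + (\<Sum>e\<in>B. fun_scale (- c e) (?u e))"
        using aB fin by (simp add: x_def) (intro sum.cong, auto)
      moreover have "\<dots> = 0" by (simp add: c sum_negf)
      ultimately have "x \<in> rowspace R E V" using relation by metis
      then show "\<exists>x\<in>rowspace R E V. x a = 1 \<and> (\<forall>b\<in>A - {a}. x b = 0)"
        using B by (intro bexI[of _ x]) (auto simp: x_def)
    qed
    then show "A \<in> indep (column_matroid R E V)"
      using columns_independent_iff_dual_vectors[OF R fin(1,3)] fin by auto
  qed
  then have "indep (column_matroid R E V) = {A. \<exists>B\<in>bases ?N. A \<subseteq> E - B}"
    by blast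
  then show ?thesis
    unfolding dual_matroid_def by (simp add: matroid.expand)
qed

section \<open>Pluecker coordinates of subspaces of a rowspace\<close>

definition rows_independent :: "'r set \<Rightarrow> 'c set \<Rightarrow> ('r \<Rightarrow> 'c \<Rightarrow> 'k::field) \<Rightarrow> bool" where
  "rows_independent R C M \<longleftrightarrow>
    (\<forall>c. (\<forall>j\<in>C. (\<Sum>r\<in>R. c r * M r j) = 0) \<longrightarrow> (\<forall>r\<in>R. c r = 0))"

lemma rows_independent_iff:
  assumes "finite R"
  shows "rows_independent R C M \<longleftrightarrow>
    inj_on (mat_row C M) R \<and> fun_vs.independent (mat_row C M ` R)"
proof -
  have "(\<Sum>r\<in>R. fun_scale (c r) (mat_row C M r)) = (\<lambda>j. if j \<in> C then \<Sum>r\<in>R. c r * M r j else 0)" for c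
    by (auto simp: fun_eq_iff sum_fun_apply fun_scale_def mat_row_def)
  then have "(\<Sum>r\<in>R. fun_scale (c r) (mat_row C M r)) = 0 \<longleftrightarrow> (\<forall>j\<in>C. (\<Sum>r\<in>R. c r * M r j) = 0)" for c
    by (auto simp: fun_eq_iff)
  then show ?thesis
    unfolding fun_vs.independent_family_iff[OF assms] rows_independent_def by simp
qed

lemma (in vector_space) dim_image_eq_card_iff:
  assumes "finite I"
  shows "dim (f ` I) = card I \<longleftrightarrow> inj_on f I \<and> independent (f ` I)"
proof
  assume dim: "dim (f ` I) = card I"
  obtain B where B: "B \<subseteq> f ` I" "independent B" "card B = dim (f ` I)"
    by (rule basis_exists)
  have "card B \<le> card (f ` I)" by (rule card_mono[OF finite_imageI[OF assms] B(1)])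
  moreover have "card (f ` I) \<le> card I" using assms by (rule card_image_le)
  ultimately have c: "card B = card (f ` I)" "card (f ` I) = card I" using dim B(3) by linarith+
  have "B = f ` I" by (rule card_subset_eq[OF finite_imageI[OF assms] B(1) c(1)])
  then show "inj_on f I \<and> independent (f ` I)"
    using B(2) eq_card_imp_inj_on[OF assms c(2)] by blast
next
  assume "inj_on f I \<and> independent (f ` I)"
  then show "dim (f ` I) = card I" by (metis dim_eq_card_independent card_image)
qed

lemma dim_rowspace_eq_card_iff:
  assumes "finite R"
  shows "fun_vs.dim (rowspace R C M) = card R \<longleftrightarrow> rows_independent R C M"
  unfolding rowspace_def rows_independent_iff[OF assms] fun_vs.dim_span
  by (rule fun_vs.dim_image_eq_card_iff[OF assms])

text \<open>Given a nonzero minor of the first \<open>m\<close> rows with columns \<open>J\<close>,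
  its signed variants with one of the \<open>m + 1\<close> rows omitted are coefficients of a
  nontrivial combination of these rows. By independence this combination is nonzero at some
  \<open>j\<close>, where its value is, up to sign, the minor with columns
  \<open>insert j J\<close>.\<close>

lemma rows_independent_nonzero_minor:
  fixes M :: "nat \<Rightarrow> nat \<Rightarrow> 'k::field"
  assumes "finite C" "rows_independent {1..m} C M"
  obtains J where "J \<subseteq> C" "card J = m" "minor M {1..m} J \<noteq> 0"
proof -
  have "\<exists>J\<subseteq>C. card J = m \<and> minor M {1..m} J \<noteq> 0"
    using assms(2)
  proof (induction m)
    case 0
    show ?case by (intro exI[of _ "{}"]) (simp add: minor_def)
  next
    case (Suc m)
    have R: "{1..Suc m} = insert (Suc m) {1..m}" by auto
    have "rows_independent {1..m} C M"
      unfolding rows_independent_def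
    proof (intro allI impI)
      fix c assume c: "\<forall>j\<in>C. (\<Sum>r\<in>{1..m}. c r * M r j) = 0"
      have "\<forall>j\<in>C. (\<Sum>r\<in>{1..Suc m}. (c(Suc m := 0)) r * M r j) = 0"
        using c by (simp add: R)
      then have 0: "\<forall>r\<in>{1..Suc m}. (c(Suc m := 0)) r = 0"
        using Suc.prems[unfolded rows_independent_def, THEN spec, of "c(Suc m := 0)"] by (rule rev_mp)
      show "\<forall>r\<in>{1..m}. c r = 0"
      proof
        fix r assume r: "r \<in> {1..m}"
        then have "r \<in> {1..Suc m}" "r \<noteq> Suc m" by simp_all
        then show "c r = 0" using bspec[OF 0, of r] by simp
      qed
    qed
    then obtain J where J: "J \<subseteq> C" "card J = m" "minor M {1..m} J \<noteq> 0"
      using Suc.IH by blast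
    have fJ: "finite J" using J(1) assms(1) finite_subset by blast
    have cR: "card {1..Suc m} = Suc (card J)" using J by simp
    define c where "c r = (-1) ^ card {r' \<in> {1..Suc m}. r' < r} * minor M ({1..Suc m} - {r}) J" for r
    have "{1..Suc m} - {Suc m} = {1..m}" by auto
    then have "c (Suc m) \<noteq> 0" using J(3) by (simp add: c_def)
    then have "\<not> (\<forall>r\<in>{1..Suc m}. c r = 0)" by auto
    then obtain j where j: "j \<in> C" "(\<Sum>r\<in>{1..Suc m}. c r * M r j) \<noteq> 0"
      using Suc.prems[unfolded rows_independent_def, THEN spec, of c] by blast
    have sum: "(\<Sum>r\<in>{1..Suc m}. c r * M r j) =
      (\<Sum>r\<in>{1..Suc m}. (-1) ^ card {r' \<in> {1..Suc m}. r' < r} * M r j * minor M ({1..Suc m} - {r}) J)"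
      by (simp add: c_def mult_ac)
    have jJ: "j \<notin> J"
      using minor_expand_repeated_column[OF fJ _ _ cR, of j M] j(2) sum by auto
    have "minor M {1..Suc m} (insert j J) = (-1) ^ card {a \<in> J. a < j} * (\<Sum>r\<in>{1..Suc m}. c r * M r j)"
      unfolding minor_insert_column[OF fJ jJ _ cR, of M, OF finite_atLeastAtMost] sum
      by (simp only: sum_distrib_left power_add mult.assoc)
    then have "minor M {1..Suc m} (insert j J) \<noteq> 0" using j(2) by simp
    then show ?case using J j(1) jJ fJ by (intro exI[of _ "insert j J"]) auto
  qed
  then show ?thesis using that by blast
qed

section \<open>Contractions of \<open>W\<close> with \<open>V\<close>\<close>

lemma subsets_D:
  assumes "J \<in> subsets n m"
  shows "finite J" "card J = m" "J \<subseteq> {1..n}"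
  using assms finite_subset[of J "{1..n}"] by (auto simp: subsets_def)

lemma finite_subsets: "finite (subsets n m)"
proof -
  have "subsets n m \<subseteq> Pow {1..n}" by (auto simp: subsets_def)
  then show ?thesis by (rule finite_subset) simp
qed

lemma subsets_insert:
  assumes "J \<in> subsets n m" "k \<in> {1..n}" "k \<notin> J"
  shows "insert k J \<in> subsets n (Suc m)"
  using assms subsets_D[OF assms(1)] unfolding subsets_def by simp

lemma subsets_remove:
  assumes "J \<in> subsets n (Suc m)" "k \<in> J"
  shows "J - {k} \<in> subsets n m"
proof -
  note J = subsets_D[OF assms(1)]
  have "J - {k} \<subseteq> {1..n}" using J(3) by blast
  moreover have "card (J - {k}) = m" using J(1,2) assms(2) by simp
  ultimately show ?thesis by (simp add: subsets_def)
qed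

lemma card_less_Diff_singleton: "card {a \<in> A - {i}. a < i} = card {a \<in> A. a < i}" for i :: nat
  by (rule arg_cong[where f = card]) auto

text \<open>Puts the sign of \<open>V\<close> into the form of the Laplace expansions:
  \<open>i + 1\<close> has the parity of \<open>i - 1\<close>, the number of row indices below
  \<open>i\<close>.\<close>

lemma V_mat_eq:
  assumes "i \<in> {1..d + 1}"
  shows "V_mat d W i J = (-1) ^ card {r \<in> {1..d + 1}. r < i} * minor W ({1..d + 1} - {i}) J"
proof -
  have "{r \<in> {1..d + 1}. r < i} = {1..<i}" using assms by auto
  moreover have "(-1 :: 'a) ^ (i + 1) = (-1) ^ (i - 1)"
    using assms by (cases i) auto
  ultimately show ?thesis by (simp add: V_mat_def)
qed

text \<open>Expansion along column \<open>k\<close> of the matrix obtained by adjoining this column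
  to the columns \<open>J\<close>: a repeated column if \<open>k\<close> is in \<open>J\<close>, a
  new one otherwise.\<close>

lemma sum_V_mat_mult:
  fixes W :: "nat \<Rightarrow> nat \<Rightarrow> 'k::field"
  assumes J: "finite J" "card J = d"
  shows "(\<Sum>i\<in>{1..d + 1}. V_mat d W i J * W i k) =
    (if k \<in> J then 0 else (-1) ^ card {a \<in> J. a < k} * minor W {1..d + 1} (insert k J))"
proof -
  have c: "card {1..d + 1} = Suc (card J)" using J by simp
  have sum: "(\<Sum>i\<in>{1..d + 1}. V_mat d W i J * W i k) =
    (\<Sum>r\<in>{1..d + 1}. (-1) ^ card {r' \<in> {1..d + 1}. r' < r} * W r k * minor W ({1..d + 1} - {r}) J)"
    by (intro sum.cong refl) (simp only: V_mat_eq mult_ac)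
  show ?thesis
  proof (cases "k \<in> J")
    case True
    then show ?thesis
      using sum minor_expand_repeated_column[OF J(1) True finite_atLeastAtMost c, of W] by simp
  next
    case False
    have "minor W {1..d + 1} (insert k J) = (-1) ^ card {a \<in> J. a < k} *
      (\<Sum>i\<in>{1..d + 1}. V_mat d W i J * W i k)"
      unfolding minor_insert_column[OF J(1) False finite_atLeastAtMost c, of W] sum
      by (simp only: sum_distrib_left power_add mult.assoc)
    then show ?thesis using False by (simp add: mult.assoc[symmetric] power_add[symmetric])
  qed
qed

text \<open>The sum expands the minor of \<open>W\<close> with columns \<open>J\<close> after its
  row \<open>i'\<close> has been replaced by its row \<open>i\<close>.\<close>

lemma sum_mult_V_mat:
  fixes W :: "nat \<Rightarrow> nat \<Rightarrow> 'k::field"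
  assumes J: "finite J" "card J = d + 1" and i: "i \<in> {1..d + 1}" and i': "i' \<in> {1..d + 1}"
  shows "(\<Sum>j\<in>J. (-1) ^ card {a \<in> J. a < j} * W i j * V_mat d W i' (J - {j})) =
    (if i = i' then minor W {1..d + 1} J else 0)"
proof -
  let ?R = "{1..d + 1} - {i'}"
  have c: "card J = Suc (card ?R)" using J i' by simp
  let ?s = "(-1) ^ card {r \<in> {1..d + 1}. r < i'} :: 'k"
  have sum: "(\<Sum>j\<in>J. (-1) ^ card {a \<in> J. a < j} * W i j * V_mat d W i' (J - {j})) =
    ?s * (\<Sum>j\<in>J. (-1) ^ card {a \<in> J. a < j} * W i j * minor W ?R (J - {j}))"
    by (simp only: V_mat_eq[OF i'] sum_distrib_left mult_ac)
  show ?thesis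
  proof (cases "i = i'")
    case True
    have "minor W (insert i' ?R) J =
      ?s * (\<Sum>j\<in>J. (-1) ^ card {a \<in> J. a < j} * W i' j * minor W ?R (J - {j}))"
      by (subst minor_insert_row[OF finite_Diff[OF finite_atLeastAtMost] _ J(1) c])
        (simp, simp only: card_less_Diff_singleton sum_distrib_left power_add mult.assoc)
    moreover have "insert i' ?R = {1..d + 1}" using i' by auto
    ultimately show ?thesis using True sum by simp
  next
    case False
    then have "i \<in> ?R" using i by simp
    then show ?thesis
      using sum False minor_expand_repeated_row[OF finite_Diff[OF finite_atLeastAtMost] _ J(1) c, of i W] by simp
  qed
qed

section \<open>The incidence relations \<open>U\<close>\<close>

definition U_kernel :: "nat \<Rightarrow> nat \<Rightarrow> (nat \<Rightarrow> nat \<Rightarrow> 'k::field) \<Rightarrow> (nat set \<Rightarrow> 'k) set" where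
  "U_kernel d n W = {p \<in> coord_space (subsets n d).
    \<forall>s\<in>U_rows d n. (\<Sum>J\<in>subsets n d. U_mat d W s J * p J) = 0}"

lemma subspace_U_kernel: "fun_vs.subspace (U_kernel d n W)"
  by (auto simp: fun_vs.subspace_def U_kernel_def coord_space_def fun_scale_def
      distrib_left sum.distrib mult.left_commute sum_distrib_left[symmetric])

text \<open>The interval \<open>{1..i}\<close> contains \<open>i\<close> itself, which is in
  \<open>B\<close> but not in \<open>A\<close>. The exponent in \<open>U\<close> therefore exceeds
  the Laplace exponent by one, whence the minus sign.\<close>

lemma U_mat_insert:
  assumes "i \<in> B - A" "A \<subseteq> {1..n}" "B \<subseteq> {1..n}"
  shows "U_mat d W (A, B) (insert i A) =
    - ((-1) ^ (card {a \<in> A. a < i} + card {b \<in> B. b < i}) * minor W {1..d + 1} (B - {i}))"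
proof -
  have the: "(THE j. j \<in> B - A \<and> insert i A = A \<union> {j}) = i"
    using assms(1) by (intro the_equality) auto
  have A: "{1..i} \<inter> A = {a \<in> A. a < i}"
    using assms by (auto simp: less_le)
  have B: "{1..i} \<inter> B = insert i {b \<in> B. b < i}"
    using assms by (auto simp: less_le)
  have "finite {b \<in> B. b < i}" by simp
  then have "card ({1..i} \<inter> B) = Suc (card {b \<in> B. b < i})" unfolding B by simp
  moreover have "\<exists>j\<in>B - A. insert i A = A \<union> {j}" using assms(1) by auto
  ultimately show ?thesis
    unfolding U_mat_def by (simp only: the A Let_def case_prod_conv if_True) simp
qed

lemma U_mat_sum:
  fixes W :: "nat \<Rightarrow> nat \<Rightarrow> 'k::field"
  assumes AB: "(A, B) \<in> U_rows d n"
  shows "(\<Sum>J\<in>subsets n d. U_mat d W (A, B) J * p J) =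
    - (\<Sum>i\<in>B - A. (-1) ^ (card {a \<in> A. a < i} + card {b \<in> B. b < i}) * minor W {1..d + 1} (B - {i}) * p (insert i A))"
proof -
  have A: "A \<subseteq> {1..n}" "card A + 1 = d" "finite A" and B: "B \<subseteq> {1..n}"
    using AB finite_subset[of A "{1..n}"] by (auto simp: U_rows_def subsets_def)
  have sub: "(\<lambda>i. insert i A) ` (B - A) \<subseteq> subsets n d"
    using A B by (auto simp: subsets_def)
  have "(\<Sum>J\<in>subsets n d. U_mat d W (A, B) J * p J) = (\<Sum>J\<in>(\<lambda>i. insert i A) ` (B - A). U_mat d W (A, B) J * p J)"
    by (intro sum.mono_neutral_right[OF finite_subsets sub]) (auto simp: U_mat_def)
  also have "\<dots> = (\<Sum>i\<in>B - A. U_mat d W (A, B) (insert i A) * p (insert i A))"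
    by (rule sum.reindex[unfolded o_def]) (auto simp: inj_on_def)
  also have "\<dots> = (\<Sum>i\<in>B - A. - ((-1) ^ (card {a \<in> A. a < i} + card {b \<in> B. b < i}) *
      minor W {1..d + 1} (B - {i}) * p (insert i A)))"
    using A B by (intro sum.cong refl) (simp add: U_mat_insert)
  finally show ?thesis by (simp add: sum_negf)
qed

text \<open>The equations of \<open>X\<close> with Pluecker coordinates as coefficients. By
  linearity \<open>x\<close> may be taken to be a row of \<open>W\<close>, and then the sum is an
  expansion along a repeated row.\<close>

lemma rowspace_linear_equation:
  fixes W :: "nat \<Rightarrow> nat \<Rightarrow> 'k::field"
  assumes x: "x \<in> rowspace {1..m} {1..n} W" and B: "B \<in> subsets n (m + 1)"
  shows "(\<Sum>b\<in>B. (-1) ^ card {b' \<in> B. b' < b} * minor W {1..m} (B - {b}) * x b) = 0"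
proof -
  obtain c where c: "x = (\<lambda>j. if j \<in> {1..n} then \<Sum>r\<in>{1..m}. c r * W r j else 0)"
    using x rowspace_iff by blast
  have "(\<Sum>b\<in>B. (-1) ^ card {b' \<in> B. b' < b} * minor W {1..m} (B - {b}) * x b) =
    (\<Sum>b\<in>B. \<Sum>r\<in>{1..m}. c r * ((-1) ^ card {b' \<in> B. b' < b} * W r b * minor W {1..m} (B - {b})))"
    using subsets_D(3)[OF B] by (intro sum.cong refl) (auto simp: c sum_distrib_left sum_distrib_right mult_ac)
  also have "\<dots> = (\<Sum>r\<in>{1..m}. c r * (\<Sum>b\<in>B. (-1) ^ card {b' \<in> B. b' < b} * W r b * minor W {1..m} (B - {b})))"
    by (subst sum.swap) (simp add: sum_distrib_left)
  also have "\<dots> = 0"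
    using subsets_D[OF B] by (intro sum.neutral ballI) (simp add: minor_expand_repeated_row)
  finally show ?thesis .
qed

text \<open>For fixed \<open>A\<close>, the contraction \<open>i \<mapsto> \<plusminus>p\<^bsub>A \<union> i\<^esub>\<close> is a linear combination of the rows of \<open>M\<close>,
  hence a point of \<open>X\<close>; the equation of \<open>U\<close> for \<open>(A, B)\<close> is the linear equation of \<open>X\<close> for \<open>B\<close>.\<close>

lemma minors_in_U_kernel:
  fixes W M :: "nat \<Rightarrow> nat \<Rightarrow> 'k::field"
  assumes R: "finite R" "card R = d"
    and rows: "\<And>r. r \<in> R \<Longrightarrow> mat_row {1..n} M r \<in> rowspace {1..d + 1} {1..n} W"
  shows "(\<lambda>J. if J \<in> subsets n d then minor M R J else 0) \<in> U_kernel d n W" (is "?p \<in> _")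
  unfolding U_kernel_def
proof (intro CollectI conjI ballI)
  show "?p \<in> coord_space (subsets n d)" by (simp add: coord_space_def)
  fix s assume "s \<in> U_rows d n"
  then obtain A B where s: "s = (A, B)" and AB: "(A, B) \<in> U_rows d n" by (cases s) auto
  have A: "A \<subseteq> {1..n}" "card A + 1 = d" "finite A" and B: "B \<in> subsets n (d + 2)"
    using AB finite_subset[of A "{1..n}"] by (auto simp: U_rows_def)
  note B' = subsets_D[OF B]
  have cR: "card R = Suc (card A)" using R A by simp
  define g where "g i = (\<Sum>r\<in>R. (-1) ^ card {r' \<in> R. r' < r} * M r i * minor M (R - {r}) A)" for i
  let ?q = "\<lambda>i. (-1) ^ card {b \<in> B. b < i} * minor W {1..d + 1} (B - {i})"
  have g_in: "g i = 0" if "i \<in> A" for i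
    unfolding g_def by (rule minor_expand_repeated_column[OF A(3) that R(1) cR])
  have g_out: "(-1) ^ card {a \<in> A. a < i} * ?p (insert i A) = g i" if "i \<in> B - A" for i
  proof -
    have "insert i A \<in> subsets n d" using that A B' by (auto simp: subsets_def)
    moreover have "minor M R (insert i A) = (-1) ^ card {a \<in> A. a < i} * g i"
      using that unfolding g_def
      by (subst minor_insert_column[OF A(3) _ R(1) cR]) (simp_all add: sum_distrib_left power_add mult.assoc)
    ultimately show ?thesis by (simp add: mult.assoc[symmetric] power_add[symmetric])
  qed
  have "(\<Sum>J\<in>subsets n d. U_mat d W s J * ?p J) = - (\<Sum>i\<in>B - A. ?q i * ((-1) ^ card {a \<in> A. a < i} * ?p (insert i A)))"
    unfolding s U_mat_sum[OF AB] by (simp only: power_add mult_ac)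
  also have "(\<Sum>i\<in>B - A. ?q i * ((-1) ^ card {a \<in> A. a < i} * ?p (insert i A))) = (\<Sum>i\<in>B - A. ?q i * g i)"
    using g_out by (intro sum.cong refl) presburger
  \<comment> \<open>The contraction \<open>g\<close> vanishes on \<open>A\<close>, so the sum may be
    extended to all of \<open>B\<close>, as the linear equation of \<open>X\<close>
    requires.\<close>
  also have "\<dots> = (\<Sum>i\<in>B. ?q i * g i)"
    using B' g_in by (intro sum.mono_neutral_left) auto
  also have "\<dots> = (\<Sum>i\<in>B. \<Sum>r\<in>R. (-1) ^ card {r' \<in> R. r' < r} * minor M (R - {r}) A * (?q i * M r i))"
    by (simp only: g_def sum_distrib_left mult_ac)
  also have "\<dots> = (\<Sum>r\<in>R. (-1) ^ card {r' \<in> R. r' < r} * minor M (R - {r}) A * (\<Sum>i\<in>B. ?q i * M r i))"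
    by (subst sum.swap) (simp only: sum_distrib_left)
  also have "\<dots> = 0"
  proof (intro sum.neutral ballI)
    fix r assume "r \<in> R"
    have "(\<Sum>i\<in>B. ?q i * M r i) = (\<Sum>i\<in>B. ?q i * mat_row {1..n} M r i)"
      using B' by (intro sum.cong refl) (auto simp: mat_row_def)
    also have "\<dots> = 0"
      using rowspace_linear_equation[OF rows[OF \<open>r \<in> R\<close>], of B] B by simp
    finally show "(-1) ^ card {r' \<in> R. r' < r} * minor M (R - {r}) A * (\<Sum>i\<in>B. ?q i * M r i) = 0" by simp
  qed
  finally show "(\<Sum>J\<in>subsets n d. U_mat d W s J * ?p J) = 0" by simp
qed

text \<open>The equation for \<open>A = J - {k}\<close> and \<open>B = J\<^sub>0 \<union> {k}\<close> with \<open>k \<in> J - J\<^sub>0\<close> expresses \<open>p\<^sub>J\<close> through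
  coordinates whose index has one more element in common with \<open>J\<^sub>0\<close>.\<close>

lemma U_kernel_eq_0:
  fixes W :: "nat \<Rightarrow> nat \<Rightarrow> 'k::field"
  assumes p: "p \<in> U_kernel d n W" and J0: "J0 \<in> subsets n (d + 1)" "minor W {1..d + 1} J0 \<noteq> 0"
    and zero: "\<And>j. j \<in> J0 \<Longrightarrow> p (J0 - {j}) = 0"
  shows "p = 0"
proof -
  note J0' = subsets_D[OF J0(1)]
  have "p J = 0" if "J \<in> subsets n d" for J
    using that
  proof (induction "card (J - J0)" arbitrary: J rule: less_induct)
    case less
    note J = subsets_D[OF less.prems]
    show ?case
    proof (cases "J \<subseteq> J0")
      case True
      then have "card (J0 - J) = 1" using J J0' by (simp add: card_Diff_subset)
      then obtain j where "J0 - J = {j}" by (auto simp: card_1_singleton_iff)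
      then have "J = J0 - {j}" "j \<in> J0" using True by auto
      then show ?thesis using zero by simp
    next
      case False
      then obtain k where k: "k \<in> J" "k \<notin> J0" by blast
      let ?A = "J - {k}" and ?B = "insert k J0"
      have "?B \<in> subsets n (d + 2)" using subsets_insert[OF J0(1), of k] k J by auto
      moreover have "card ?A + 1 = d" using k J by (metis card_Suc_Diff1 Suc_eq_plus1)
      ultimately have AB: "(?A, ?B) \<in> U_rows d n" using J by (auto simp: U_rows_def)
      have p0: "p (insert i ?A) = 0" if "i \<in> ?B - ?A - {k}" for i
      proof (rule less.hyps)
        have "insert i ?A - J0 = (J - J0) - {k}" using that by auto
        moreover have "card ((J - J0) - {k}) < card (J - J0)"
          using k J by (intro card_Diff1_less) auto
        ultimately show "card (insert i ?A - J0) < card (J - J0)" by simp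
        show "insert i ?A \<in> subsets n d"
          using that k J J0' \<open>card ?A + 1 = d\<close> by (auto simp: subsets_def)
      qed
      have 0: "(\<Sum>i\<in>?B - ?A - {k}. (-1) ^ (card {a \<in> ?A. a < i} + card {b \<in> ?B. b < i}) *
          minor W {1..d + 1} (?B - {i}) * p (insert i ?A)) = 0"
      proof (intro sum.neutral ballI)
        fix i assume "i \<in> ?B - ?A - {k}"
        then have p0_i: "p (insert i ?A) = 0" by (rule p0)
        show "(-1) ^ (card {a \<in> ?A. a < i} + card {b \<in> ?B. b < i}) *
          minor W {1..d + 1} (?B - {i}) * p (insert i ?A) = 0"
          unfolding p0_i by (rule mult_zero_right)
      qed
      have k': "k \<in> ?B - ?A" "finite (?B - ?A)" using J0' by simp_all
      have eq: "?B - {k} = J0" "insert k ?A = J" using k by auto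
      have "(\<Sum>i\<in>?B - ?A. (-1) ^ (card {a \<in> ?A. a < i} + card {b \<in> ?B. b < i}) *
          minor W {1..d + 1} (?B - {i}) * p (insert i ?A)) =
        (-1) ^ (card {a \<in> ?A. a < k} + card {b \<in> ?B. b < k}) * minor W {1..d + 1} J0 * p J"
        unfolding sum.remove[OF k'(2,1)] 0 eq by (rule add_0_right)
      then have "(\<Sum>J\<in>subsets n d. U_mat d W (?A, ?B) J * p J) =
        - ((-1) ^ (card {a \<in> ?A. a < k} + card {b \<in> ?B. b < k}) * minor W {1..d + 1} J0 * p J)"
        unfolding U_mat_sum[OF AB] by simp
      then show ?thesis using p AB J0(2) by (auto simp: U_kernel_def)
    qed
  qed
  then show ?thesis
    using p by (auto simp: U_kernel_def coord_space_def fun_eq_iff)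
qed

definition row_combination :: "'r set \<Rightarrow> 'c set \<Rightarrow> ('r \<Rightarrow> 'c \<Rightarrow> 'k::field) \<Rightarrow> ('r \<Rightarrow> 'k) \<Rightarrow> 'c \<Rightarrow> 'k" where
  "row_combination R C M c = (\<lambda>j. if j \<in> C then \<Sum>r\<in>R. c r * M r j else 0)"

lemma rowspace_eq: "finite R \<Longrightarrow> rowspace R C M = range (row_combination R C M)"
  unfolding row_combination_def by (rule Set.set_eqI) (auto simp: rowspace_iff image_iff)

lemma row_combination_eq_0_iff:
  assumes "rows_independent R C M"
  shows "row_combination R C M c = 0 \<longleftrightarrow> (\<forall>r\<in>R. c r = 0)"
proof -
  have "row_combination R C M c = 0 \<longleftrightarrow> (\<forall>j\<in>C. (\<Sum>r\<in>R. c r * M r j) = 0)"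
    by (auto simp: row_combination_def fun_eq_iff)
  also have "\<dots> \<longleftrightarrow> (\<forall>r\<in>R. c r = 0)"
    using assms unfolding rows_independent_def by auto
  finally show ?thesis .
qed

section \<open>The kernel of \<open>U\<close> is the rowspace of \<open>V\<close>\<close>

locale full_rank_matrix =
  fixes d n :: nat and W :: "nat \<Rightarrow> nat \<Rightarrow> 'k::field"
  assumes rows_independent: "rows_independent {1..d + 1} {1..n} W"
begin

abbreviation "X \<equiv> rowspace {1..d + 1} {1..n} W"
abbreviation "V \<equiv> V_mat d W"
abbreviation "q \<equiv> minor W {1..d + 1}"
abbreviation "LX \<equiv> rowspace {1..d + 1} (subsets n d) V"

lemma obtain_nonzero_minor:
  obtains J0 where "J0 \<in> subsets n (d + 1)" "q J0 \<noteq> 0"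
proof -
  obtain J where "J \<subseteq> {1..n}" "card J = d + 1" "q J \<noteq> 0"
    by (rule rows_independent_nonzero_minor[OF finite_atLeastAtMost rows_independent])
  then show ?thesis by (intro that[of J]) (simp_all add: subsets_def)
qed

text \<open>Since \<open>q J0\<close> can be chosen nonzero, the coefficients \<open>c\<close> are
  determined by the \<open>d + 1\<close> coordinates at the sets \<open>J0 - {j}\<close>.\<close>

lemma coefficient_of_V_combination:
  assumes J0: "J0 \<in> subsets n (d + 1)" and i: "i \<in> {1..d + 1}"
  shows "(\<Sum>j\<in>J0. (-1) ^ card {a \<in> J0. a < j} * W i j * row_combination {1..d + 1} (subsets n d) V c (J0 - {j})) = c i * q J0"
proof -
  have "(\<Sum>j\<in>J0. (-1) ^ card {a \<in> J0. a < j} * W i j * row_combination {1..d + 1} (subsets n d) V c (J0 - {j})) =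
    (\<Sum>j\<in>J0. \<Sum>i'\<in>{1..d + 1}. c i' * ((-1) ^ card {a \<in> J0. a < j} * W i j * V i' (J0 - {j})))"
    using subsets_remove[of J0 n d] J0
    by (intro sum.cong refl) (simp add: row_combination_def sum_distrib_left mult_ac del: sum.cl_ivl_Suc)
  also have "\<dots> = (\<Sum>i'\<in>{1..d + 1}. c i' * (\<Sum>j\<in>J0. (-1) ^ card {a \<in> J0. a < j} * W i j * V i' (J0 - {j})))"
    by (subst sum.swap) (simp only: sum_distrib_left)
  also have "\<dots> = (\<Sum>i'\<in>{1..d + 1}. if i = i' then c i' * q J0 else 0)"
    using sum_mult_V_mat[OF subsets_D(1,2)[OF J0] i, of _ W] by (intro sum.cong refl) simp
  also have "\<dots> = c i * q J0"
    using i by (subst sum.delta'[OF finite_atLeastAtMost]) simp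
  finally show ?thesis .
qed

lemma V_rows_independent: "rows_independent {1..d + 1} (subsets n d) V"
  unfolding rows_independent_def
proof (intro allI impI ballI)
  fix c i assume c: "\<forall>J\<in>subsets n d. (\<Sum>i\<in>{1..d + 1}. c i * V i J) = 0" and i: "i \<in> {1..d + 1}"
  have "row_combination {1..d + 1} (subsets n d) V c J = 0" for J
    using c by (simp add: row_combination_def)
  moreover obtain J0 where J0: "J0 \<in> subsets n (d + 1)" "q J0 \<noteq> 0"
    by (rule obtain_nonzero_minor)
  ultimately have "c i * q J0 = 0" using coefficient_of_V_combination[OF J0(1) i, of c] by simp
  then show "c i = 0" using J0 by simp
qed

lemma mat_row_in_X: "r \<in> {1..d + 1} \<Longrightarrow> mat_row {1..n} W r \<in> X"
  unfolding rowspace_def by (intro fun_vs.span_base imageI)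

lemma V_row_in_U_kernel:
  assumes "i \<in> {1..d + 1}"
  shows "mat_row (subsets n d) V i \<in> U_kernel d n W"
proof -
  have "(\<lambda>J. if J \<in> subsets n d then minor W ({1..d + 1} - {i}) J else 0) \<in> U_kernel d n W"
    using assms by (intro minors_in_U_kernel mat_row_in_X) auto
  then have "fun_scale ((-1) ^ (i + 1)) (\<lambda>J. if J \<in> subsets n d then minor W ({1..d + 1} - {i}) J else 0) \<in> U_kernel d n W"
    by (rule fun_vs.subspace_scale[OF subspace_U_kernel])
  moreover have "fun_scale ((-1) ^ (i + 1)) (\<lambda>J. if J \<in> subsets n d then minor W ({1..d + 1} - {i}) J else 0) =
      mat_row (subsets n d) V i"
    by (auto simp: fun_scale_def mat_row_def V_mat_def fun_eq_iff)
  ultimately show ?thesis by simp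
qed

lemma U_kernel_eq: "U_kernel d n W = LX"
proof
  show "LX \<subseteq> U_kernel d n W"
    unfolding rowspace_def
    by (intro fun_vs.span_minimal subspace_U_kernel image_subsetI V_row_in_U_kernel)
  show "U_kernel d n W \<subseteq> LX"
  proof
    fix p assume p: "p \<in> U_kernel d n W"
    obtain J0 where J0: "J0 \<in> subsets n (d + 1)" "q J0 \<noteq> 0"
      by (rule obtain_nonzero_minor)
    note J0' = subsets_D[OF J0(1)]
    \<comment> \<open>The only possible coefficients: \<open>coefficient_of_V_combination\<close>
      solved for \<open>c i\<close>, with \<open>p\<close> in place of the combination.\<close>
    define c where "c i = (\<Sum>j\<in>J0. (-1) ^ card {a \<in> J0. a < j} * W i j * p (J0 - {j})) / q J0" for i
    let ?x = "row_combination {1..d + 1} (subsets n d) V c"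
    have x: "?x \<in> LX" by (simp add: rowspace_eq)
    have "p - ?x = 0"
    proof (rule U_kernel_eq_0[OF _ J0])
      show "p - ?x \<in> U_kernel d n W"
        using p x \<open>LX \<subseteq> U_kernel d n W\<close> by (intro fun_vs.subspace_diff[OF subspace_U_kernel]) auto
      fix k assume k: "k \<in> J0"
      let ?J = "J0 - {k}"
      have J: "?J \<in> subsets n d" using subsets_remove[of J0 n d k] J0 k by simp
      have "q J0 * ?x ?J = (\<Sum>i\<in>{1..d + 1}. (\<Sum>j\<in>J0. (-1) ^ card {a \<in> J0. a < j} * W i j * p (J0 - {j})) * V i ?J)"
        using J J0(2) by (simp add: row_combination_def sum_distrib_left c_def del: sum.cl_ivl_Suc)
      also have "\<dots> = (\<Sum>i\<in>{1..d + 1}. \<Sum>j\<in>J0. (-1) ^ card {a \<in> J0. a < j} * p (J0 - {j}) * (V i ?J * W i j))"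
        by (simp only: sum_distrib_right) (simp only: mult_ac)
      also have "\<dots> = (\<Sum>j\<in>J0. (-1) ^ card {a \<in> J0. a < j} * p (J0 - {j}) * (\<Sum>i\<in>{1..d + 1}. V i ?J * W i j))"
        by (subst sum.swap) (simp only: sum_distrib_left)
      \<comment> \<open>For \<open>j\<close> in \<open>J0 - {k}\<close> the inner sum has a repeated
        column; for \<open>j = k\<close> it is \<open>q J0\<close> with a sign that cancels the
        outer one.\<close>
      also have "\<dots> = (\<Sum>j\<in>J0. if j = k then p ?J * q J0 else 0)"
      proof (intro sum.cong refl)
        fix j assume j: "j \<in> J0"
        show "(-1) ^ card {a \<in> J0. a < j} * p (J0 - {j}) * (\<Sum>i\<in>{1..d + 1}. V i ?J * W i j) =
          (if j = k then p ?J * q J0 else 0)"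
        proof (cases "j = k")
          case True
          have "insert k ?J = J0" using k by auto
          then show ?thesis
            unfolding sum_V_mat_mult[OF subsets_D(1,2)[OF J]] True card_less_Diff_singleton
            by (simp add: mult_ac power_add[symmetric])
        next
          case False
          then show ?thesis
            unfolding sum_V_mat_mult[OF subsets_D(1,2)[OF J]] using j by simp
        qed
      qed
      also have "\<dots> = p ?J * q J0" using k J0' by simp
      finally show "(p - ?x) ?J = 0" using J0(2) by simp
    qed
    then have "p = ?x" by simp
    then show "p \<in> LX" using x by simp
  qed
qed

lemma mem_rowspace_V_iff:
  assumes "x \<in> coord_space (subsets n d)"
  shows "x \<in> LX \<longleftrightarrow> (\<forall>s\<in>U_rows d n. (\<Sum>J\<in>subsets n d. U_mat d W s J * x J) = 0)"
  using assms unfolding U_kernel_eq[symmetric] by (simp add: U_kernel_def)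

section \<open>The cone over \<open>L(X)\<close>\<close>

lemma rowspace_subset_X:
  assumes "\<And>r. r \<in> R \<Longrightarrow> mat_row {1..n} M r \<in> X"
  shows "rowspace R {1..n} M \<subseteq> X"
  unfolding rowspace_def[of R]
  by (rule fun_vs.span_minimal) (use assms subspace_rowspace in auto)

lemma grassmannian_point_plucker:
  assumes "rows_independent {1..d} {1..n} M"
  shows "grassmannian_point d n (rowspace {1..d} {1..n} M) (fun_vs.span {plucker d n M})"
  unfolding grassmannian_point_def
proof (intro conjI exI[of _ M] refl)
  show "fun_vs.dim (rowspace {1..d} {1..n} M) = d"
    using assms dim_rowspace_eq_card_iff[of "{1..d}" "{1..n}" M] by simp
qed (rule subspace_rowspace rowspace_subset_coord_space)+

text \<open>If \<open>p = \<Sum>\<^sub>i c\<^sub>i V\<^sub>i\<close> with \<open>c\<^bsub>i0\<^esub> \<noteq> 0\<close>, then the subspace with Pluecker vector \<open>p\<close> is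
  \<open>{\<Sum>\<^sub>i a\<^sub>i w\<^sub>i | \<Sum>\<^sub>i a\<^sub>i c\<^sub>i = 0}\<close>, where \<open>w\<^sub>i\<close> is the \<open>i\<close>-th row of \<open>W\<close>; the rows of \<open>M\<close> below are a
  basis of it.\<close>

lemma decomposable:
  assumes c: "i0 \<in> {1..d + 1}" "c i0 \<noteq> 0"
  obtains M where "rows_independent {1..d} {1..n} M" "\<And>r. r \<in> {1..d} \<Longrightarrow> mat_row {1..n} M r \<in> X"
    "row_combination {1..d + 1} (subsets n d) V c \<in> fun_vs.span {plucker d n M}"
proof -
  let ?comb = "row_combination {1..d + 1} (subsets n d) V"
  obtain f where f: "bij_betw f {1..d} ({1..d + 1} - {i0})"
    using finite_same_card_bij[of "{1..d}" "{1..d + 1} - {i0}"] c(1) by auto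
  have f_in: "f s \<in> {1..d + 1}" "f s \<noteq> i0" if "s \<in> {1..d}" for s
    using bij_betwE[OF f] that by auto
  define M where "M s j = W (f s) j - c (f s) / c i0 * W i0 j" for s j
  have indep: "rows_independent {1..d} {1..n} M"
    unfolding rows_independent_def
  proof (intro allI impI ballI)
    fix b s assume b: "\<forall>j\<in>{1..n}. (\<Sum>s\<in>{1..d}. b s * M s j) = 0" and s: "s \<in> {1..d}"
    define g where "g = the_inv_into {1..d} f"
    have g: "g (f s) = s" if "s \<in> {1..d}" for s
      using that f by (simp add: g_def bij_betw_def the_inv_into_f_f)
    \<comment> \<open>The coefficients of the combination \<open>b\<close> of rows of
      \<open>M\<close>, rewritten in the rows of \<open>W\<close>; the corrections of all rows of
      \<open>M\<close> collect at \<open>i0\<close>.\<close>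
    define a where "a i = (if i = i0 then - (\<Sum>s\<in>{1..d}. b s * (c (f s) / c i0)) else b (g i))" for i
    have "(\<Sum>i\<in>{1..d + 1}. a i * W i j) = 0" if "j \<in> {1..n}" for j
    proof -
      have "(\<Sum>i\<in>{1..d + 1}. a i * W i j) = a i0 * W i0 j + (\<Sum>i\<in>{1..d + 1} - {i0}. a i * W i j)"
        using c(1) by (intro sum.remove) auto
      also have "(\<Sum>i\<in>{1..d + 1} - {i0}. a i * W i j) = (\<Sum>s\<in>{1..d}. a (f s) * W (f s) j)"
        by (rule sum.reindex_bij_betw[OF f, symmetric])
      also have "\<dots> = (\<Sum>s\<in>{1..d}. b s * W (f s) j)"
        using f_in g by (intro sum.cong refl) (simp add: a_def)
      also have "a i0 * W i0 j + \<dots> = (\<Sum>s\<in>{1..d}. b s * M s j)"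
        by (simp add: a_def M_def sum_distrib_right sum_distrib_left sum_subtractf right_diff_distrib mult_ac)
      also have "\<dots> = 0" using b that by blast
      finally show ?thesis .
    qed
    then have "a (f s) = 0"
      using rows_independent f_in(1)[OF s] unfolding rows_independent_def by blast
    then show "b s = 0" using f_in(2)[OF s] g[OF s] by (simp add: a_def)
  qed
  have rows: "mat_row {1..n} M s \<in> X" if "s \<in> {1..d}" for s
  proof -
    have "mat_row {1..n} M s = mat_row {1..n} W (f s) - fun_scale (c (f s) / c i0) (mat_row {1..n} W i0)"
      by (auto simp: mat_row_def M_def fun_scale_def fun_eq_iff)
    then show ?thesis
      using mat_row_in_X[OF f_in(1)[OF that]] mat_row_in_X[OF c(1)]
      by (simp only: fun_vs.subspace_diff[OF subspace_rowspace] fun_vs.subspace_scale[OF subspace_rowspace])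
  qed
  \<comment> \<open>Through the kernel of \<open>U\<close> the Pluecker vector of \<open>M\<close>
    is again a combination of the rows of \<open>V\<close>. It remains to show that its coefficients
    \<open>c'\<close> are proportional to \<open>c\<close>.\<close>
  have "plucker d n M \<in> LX"
    unfolding U_kernel_eq[symmetric] plucker_def using rows by (intro minors_in_U_kernel) auto
  then obtain c' where c': "plucker d n M = ?comb c'" by (auto simp: rowspace_eq)
  obtain J where J: "J \<subseteq> {1..n}" "card J = d" "minor M {1..d} J \<noteq> 0"
    using rows_independent_nonzero_minor[OF finite_atLeastAtMost indep] by blast
  then have nonzero: "?comb c' J \<noteq> 0"
    unfolding c'[symmetric] by (simp add: plucker_def subsets_def)
  obtain J0 where J0: "J0 \<in> subsets n (d + 1)" "q J0 \<noteq> 0"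
    by (rule obtain_nonzero_minor)
  note J0' = subsets_D[OF J0(1)]
  have c'_f: "c' (f s) = c (f s) / c i0 * c' i0" if s: "s \<in> {1..d}" for s
  proof -
    \<comment> \<open>Expansion along the repeated row \<open>s\<close> of \<open>M\<close> gives 0.
      Splitting that row into its two rows of \<open>W\<close> reads off the two coefficients
      \<open>c' (f s)\<close> and \<open>c' i0\<close>, hence a linear relation between
      them.\<close>
    have "0 = (\<Sum>j\<in>J0. (-1) ^ card {a \<in> J0. a < j} * M s j * minor M {1..d} (J0 - {j}))"
      using minor_expand_repeated_row[of "{1..d}" s J0 M] s J0' by simp
    also have "\<dots> = (\<Sum>j\<in>J0. (-1) ^ card {a \<in> J0. a < j} * M s j * ?comb c' (J0 - {j}))"
      unfolding c'[symmetric] plucker_def using J0(1) subsets_remove[of J0 n d]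
      by (intro sum.cong refl) simp
    also have "\<dots> = (\<Sum>j\<in>J0. (-1) ^ card {a \<in> J0. a < j} * W (f s) j * ?comb c' (J0 - {j})) -
        c (f s) / c i0 * (\<Sum>j\<in>J0. (-1) ^ card {a \<in> J0. a < j} * W i0 j * ?comb c' (J0 - {j}))"
      unfolding sum_distrib_left sum_subtractf[symmetric]
      by (intro sum.cong refl) (simp add: M_def algebra_simps)
    also have "\<dots> = (c' (f s) - c (f s) / c i0 * c' i0) * q J0"
      unfolding coefficient_of_V_combination[OF J0(1) f_in(1)[OF s]] coefficient_of_V_combination[OF J0(1) c(1)] by (simp add: algebra_simps)
    finally show ?thesis using J0(2) by simp
  qed
  have c'_eq: "c' i = c' i0 / c i0 * c i" if "i \<in> {1..d + 1}" for i
  proof (cases "i = i0")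
    case True
    then show ?thesis using c(2) by simp
  next
    case False
    then have "i \<in> f ` {1..d}"
      using that bij_betw_imp_surj_on[OF f] by blast
    then obtain s where "s \<in> {1..d}" "i = f s" by blast
    then show ?thesis using c'_f[of s] by simp
  qed
  have scale: "?comb c' = fun_scale (c' i0 / c i0) (?comb c)"
    by (simp add: fun_eq_iff fun_scale_def row_combination_def c'_eq sum_distrib_left sum_divide_distrib mult.assoc
        del: sum.cl_ivl_Suc)
  \<comment> \<open>The rows of \<open>M\<close> are independent, so some minor of \<open>M\<close>
    is nonzero and the factor cannot vanish.\<close>
  have "c' i0 / c i0 \<noteq> 0"
    using nonzero unfolding scale by (auto simp: fun_scale_def)
  note inv = left_inverse[OF this]
  have "?comb c = fun_scale (inverse (c' i0 / c i0)) (plucker d n M)"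
    unfolding c' scale by (simp only: fun_vs.scale_scale inv fun_vs.scale_one)
  then have "?comb c \<in> fun_vs.span {plucker d n M}"
    by (simp only:) (intro fun_vs.span_scale fun_vs.span_base singletonI)
  then show ?thesis using that indep rows by blast
qed

lemma affine_cone_grassmannian_sub: "affine_cone (grassmannian_sub d n X) = LX"
proof
  show "affine_cone (grassmannian_sub d n X) \<subseteq> LX"
  proof
    fix p assume "p \<in> affine_cone (grassmannian_sub d n X)"
    then consider "p = 0" | P where "p \<in> P" "P \<in> grassmannian_sub d n X"
      unfolding affine_cone_def by blast
    then show "p \<in> LX"
    proof cases
      case 1
      then show ?thesis using fun_vs.subspace_0[OF subspace_rowspace] by simp
    next
      case (2 P)
      then obtain M where M: "rowspace {1..d} {1..n} M \<subseteq> X" "P = fun_vs.span {plucker d n M}"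
        unfolding grassmannian_sub_def grassmannian_point_def by blast
      have "mat_row {1..n} M r \<in> X" if "r \<in> {1..d}" for r
        using M(1) that fun_vs.span_base[of "mat_row {1..n} M r" "mat_row {1..n} M ` {1..d}"]
        unfolding rowspace_def[of "{1..d}"] by blast
      then have "plucker d n M \<in> LX"
        unfolding U_kernel_eq[symmetric] plucker_def by (intro minors_in_U_kernel) auto
      then have "P \<subseteq> LX"
        unfolding M(2) by (intro fun_vs.span_minimal subspace_rowspace) simp
      then show ?thesis using 2 by blast
    qed
  qed
  show "LX \<subseteq> affine_cone (grassmannian_sub d n X)"
  proof
    fix p assume "p \<in> LX"
    then obtain c where p: "p = row_combination {1..d + 1} (subsets n d) V c" by (auto simp: rowspace_eq)
    show "p \<in> affine_cone (grassmannian_sub d n X)"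
    proof (cases "\<forall>i\<in>{1..d + 1}. c i = 0")
      case True
      then have "p = 0" unfolding p row_combination_eq_0_iff[OF V_rows_independent] .
      then show ?thesis by (simp add: affine_cone_def)
    next
      case False
      then obtain i0 where "i0 \<in> {1..d + 1}" "c i0 \<noteq> 0" by blast
      then obtain M where M: "rows_independent {1..d} {1..n} M" "\<And>r. r \<in> {1..d} \<Longrightarrow> mat_row {1..n} M r \<in> X"
        "p \<in> fun_vs.span {plucker d n M}"
        using decomposable p by metis
      then have "fun_vs.span {plucker d n M} \<in> grassmannian_sub d n X"
        unfolding grassmannian_sub_def using grassmannian_point_plucker[OF M(1)] rowspace_subset_X[OF M(2)] by blast
      then show ?thesis using M(3) unfolding affine_cone_def by blast
    qed
  qed
qed

section \<open>The matroid of lines\<close>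

definition line_vector :: "nat set \<Rightarrow> nat \<Rightarrow> 'k" where
  "line_vector J = row_combination {1..d + 1} {1..n} W (\<lambda>i. V i J)"

lemma line_vector_nth:
  assumes "J \<in> subsets n d" "k \<in> {1..n}"
  shows "line_vector J k = (if k \<in> J then 0 else (-1) ^ card {a \<in> J. a < k} * q (insert k J))"
  using assms(2) sum_V_mat_mult[OF subsets_D(1,2)[OF assms(1)], of W k]
  by (simp only: line_vector_def row_combination_def if_True)

lemma line_vector_in_X: "line_vector J \<in> X"
  by (simp add: line_vector_def rowspace_eq)

text \<open>For \<open>k\<close> outside \<open>J0\<close>, the equation of \<open>X\<close> for
  \<open>insert k J0\<close> involves only \<open>x k\<close>, with coefficient \<open>q J0\<close>
  up to sign, and coordinates in \<open>J0\<close>.\<close>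

lemma X_eq_0:
  assumes x: "x \<in> X" and J0: "J0 \<in> subsets n (d + 1)" "q J0 \<noteq> 0" and zero: "\<And>j. j \<in> J0 \<Longrightarrow> x j = 0"
  shows "x = 0"
proof (rule ext)
  fix k
  note J0' = subsets_D[OF J0(1)]
  show "x k = 0 k"
  proof (cases "k \<in> {1..n} \<and> k \<notin> J0")
    case True
    let ?B = "insert k J0"
    have B: "?B \<in> subsets n (d + 1 + 1)" using subsets_insert[OF J0(1), of k] True by simp
    have "0 = (\<Sum>b\<in>?B. (-1) ^ card {b' \<in> ?B. b' < b} * q (?B - {b}) * x b)"
      by (rule rowspace_linear_equation[OF x B, symmetric])
    also have "\<dots> = (-1) ^ card {b' \<in> ?B. b' < k} * q (?B - {k}) * x k"
      using True J0'(1) zero by (simp add: sum.insert)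
    also have "?B - {k} = J0" using True by auto
    finally show ?thesis using J0(2) by simp
  next
    case False
    then show ?thesis
      using zero[of k] x rowspace_subset_coord_space[of "{1..d + 1}" "{1..n}" W] by (auto simp: coord_space_def)
  qed
qed

text \<open>If \<open>line_vector J\<close> is nonzero at \<open>k\<close>, then
  \<open>q (insert k J)\<close> is nonzero, and a vector of the intersection is determined by its
  coordinate \<open>k\<close>. If \<open>line_vector J\<close> is 0, the intersection must be shown
  not to be a line, so that both sides are \<open>{0}\<close>.\<close>

lemma arrangement_line_eq:
  assumes J: "J \<in> subsets n d"
  shows "arrangement_line X (induced_arrangement X) J = fun_vs.span {line_vector J}"
proof -
  let ?y = "line_vector J"
  define Y where "Y = X \<inter> {x. \<forall>k\<in>J. x k = 0}"
  have Y: "X \<inter> (\<Inter>k\<in>J. induced_arrangement X k) = Y"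
    unfolding Y_def induced_arrangement_def by auto
  have y_Y: "?y \<in> Y"
    using line_vector_in_X line_vector_nth[OF J] subsets_D(3)[OF J] by (auto simp: Y_def)
  have subspace_Y: "fun_vs.subspace Y"
    unfolding Y_def using subspace_rowspace[of "{1..d + 1}" "{1..n}" W]
    by (simp add: fun_vs.subspace_def fun_scale_def)
  have sub_n: "x k = 0" if "x \<in> Y" "k \<notin> {1..n}" for x k
    using that rowspace_subset_coord_space[of "{1..d + 1}" "{1..n}" W] by (auto simp: Y_def coord_space_def)
  show ?thesis
  proof (cases "?y = 0")
    case False
    then obtain k where k: "?y k \<noteq> 0" by (auto simp: fun_eq_iff)
    then have kn: "k \<in> {1..n}" using sub_n[OF y_Y] by blast
    then have kJ: "k \<notin> J" and q: "q (insert k J) \<noteq> 0"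
      using k line_vector_nth[OF J kn] by (auto split: if_splits)
    have J0: "insert k J \<in> subsets n (d + 1)" using subsets_insert[OF J kn kJ] by simp
    have "Y = fun_vs.span {?y}"
    proof
      show "fun_vs.span {?y} \<subseteq> Y" using y_Y by (intro fun_vs.span_minimal subspace_Y) simp
      show "Y \<subseteq> fun_vs.span {?y}"
      proof
        fix x assume x: "x \<in> Y"
        let ?z = "x - fun_scale (x k / ?y k) ?y"
        have z: "?z \<in> Y"
          by (intro fun_vs.subspace_diff fun_vs.subspace_scale subspace_Y x y_Y)
        have "?z = 0"
        proof (rule X_eq_0[OF _ J0 q])
          show "?z \<in> X" using z unfolding Y_def by blast
          show "?z j = 0" if "j \<in> insert k J" for j
          proof (cases "j = k")
            case True
            then show ?thesis using k by (simp add: fun_scale_def)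
          next
            case False
            then show ?thesis using z that unfolding Y_def by blast
          qed
        qed
        then have "x = fun_scale (x k / ?y k) ?y" by simp
        then show "x \<in> fun_vs.span {?y}" unfolding fun_vs.span_singleton by (rule range_eqI)
      qed
    qed
    moreover have "fun_vs.dim (fun_vs.span {?y}) = 1"
      using False by (subst fun_vs.dim_span_eq_card_independent) simp_all
    ultimately show ?thesis unfolding arrangement_line_def Y by simp
  next
    case True
    have "fun_vs.dim Y \<noteq> 1"
    proof
      assume "fun_vs.dim Y = 1"
      then obtain D where D: "D \<subseteq> Y" "fun_vs.independent D" "Y \<subseteq> fun_vs.span D" "card D = 1"
        by (metis fun_vs.basis_exists)
      then obtain z where z: "D = {z}" by (auto simp: card_1_singleton_iff)
      then have "z \<noteq> 0" "z \<in> Y" using D by auto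
      then obtain k where k: "z k \<noteq> 0" by (auto simp: fun_eq_iff)
      then have kn: "k \<in> {1..n}" and kJ: "k \<notin> J"
        using sub_n[OF \<open>z \<in> Y\<close>] \<open>z \<in> Y\<close> unfolding Y_def by blast+
      note J' = subsets_D[OF J]
      \<comment> \<open>If \<open>z\<close> spans the intersection and \<open>z k\<close> is
        nonzero, a combination of rows of \<open>W\<close> that vanishes on
        \<open>insert k J\<close> is a multiple of \<open>z\<close> vanishing at \<open>k\<close>,
        hence 0. The resulting nonzero minor uses all \<open>d + 1\<close> columns of
        \<open>insert k J\<close>, so \<open>line_vector J\<close> would be nonzero at
        \<open>k\<close>.\<close>
      have "rows_independent {1..d + 1} (insert k J) W"
        unfolding rows_independent_def
      proof (intro allI impI)
        fix c assume c: "\<forall>j\<in>insert k J. (\<Sum>r\<in>{1..d + 1}. c r * W r j) = 0"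
        let ?x = "row_combination {1..d + 1} {1..n} W c"
        have x: "?x j = 0" if "j \<in> insert k J" for j
          unfolding row_combination_def using bspec[OF c that] by (simp only: if_cancel)
        have "?x \<in> Y" using x by (simp add: Y_def rowspace_eq)
        then obtain t where t: "?x = fun_scale t z"
          using D(3) unfolding z fun_vs.span_singleton by blast
        have "t * z k = 0" using x[of k] unfolding t by (simp add: fun_scale_def)
        then have "?x = 0" using k unfolding t by simp
        then show "\<forall>r\<in>{1..d + 1}. c r = 0"
          unfolding row_combination_eq_0_iff[OF rows_independent] .
      qed
      then obtain J0 where J0: "J0 \<subseteq> insert k J" "card J0 = d + 1" "q J0 \<noteq> 0"
        using rows_independent_nonzero_minor[of "insert k J" "d + 1" W] J'(1) by blast
      have "J0 = insert k J"
        using J0 J' kJ by (intro card_subset_eq) auto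
      then have "?y k \<noteq> 0"
        using J0(3) kJ unfolding line_vector_nth[OF J kn] by simp
      then show False using True by simp
    qed
    then show ?thesis unfolding arrangement_line_def Y True by simp
  qed
qed

text \<open>Combining the rows of \<open>W\<close> is an injective linear map on
  \<open>K^(d+1)\<close> that sends column \<open>J\<close> of \<open>V\<close> to
  \<open>line_vector J\<close>. Hence the columns and the line vectors satisfy the same linear
  relations.\<close>

lemma matroid_of_lines_eq:
  "matroid_of_lines d n X (induced_arrangement X) = column_matroid {1..d + 1} (subsets n d) V"
proof -
  have "fun_vs.dim (fun_vs.span (\<Union>J\<in>A. arrangement_line X (induced_arrangement X) J)) = card A \<longleftrightarrow>
    inj_on (mat_col {1..d + 1} V) A \<and> fun_vs.independent (mat_col {1..d + 1} V ` A)"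
    if A: "A \<subseteq> subsets n d" for A
  proof -
    have fA: "finite A" using A finite_subsets by (rule finite_subset)
    have "(\<Union>J\<in>A. arrangement_line X (induced_arrangement X) J) = (\<Union>J\<in>A. fun_vs.span {line_vector J})"
      using A arrangement_line_eq by (intro SUP_cong refl) blast
    also have "fun_vs.span \<dots> = fun_vs.span (line_vector ` A)"
    proof
      show "fun_vs.span (\<Union>J\<in>A. fun_vs.span {line_vector J}) \<subseteq> fun_vs.span (line_vector ` A)"
        by (intro fun_vs.span_minimal UN_least fun_vs.span_mono fun_vs.subspace_span) auto
      show "fun_vs.span (line_vector ` A) \<subseteq> fun_vs.span (\<Union>J\<in>A. fun_vs.span {line_vector J})"
        by (intro fun_vs.span_mono) (auto intro: fun_vs.span_base)
    qed
    finally have span: "fun_vs.dim (fun_vs.span (\<Union>J\<in>A. arrangement_line X (induced_arrangement X) J)) = fun_vs.dim (line_vector ` A)"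
      by simp
    have "(\<Sum>J\<in>A. fun_scale (c J) (line_vector J)) =
      row_combination {1..d + 1} {1..n} W (\<lambda>i. \<Sum>J\<in>A. c J * V i J)" for c
    proof (rule ext)
      fix k
      show "(\<Sum>J\<in>A. fun_scale (c J) (line_vector J)) k =
        row_combination {1..d + 1} {1..n} W (\<lambda>i. \<Sum>J\<in>A. c J * V i J) k"
      proof (cases "k \<in> {1..n}")
        case True
        have "(\<Sum>J\<in>A. fun_scale (c J) (line_vector J)) k = (\<Sum>J\<in>A. \<Sum>i\<in>{1..d + 1}. c J * V i J * W i k)"
          using True by (simp only: sum_fun_apply fun_scale_def line_vector_def row_combination_def if_True sum_distrib_left mult.assoc)
        also have "\<dots> = (\<Sum>i\<in>{1..d + 1}. (\<Sum>J\<in>A. c J * V i J) * W i k)"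
          by (subst sum.swap) (simp only: sum_distrib_right)
        finally show ?thesis using True by (simp only: row_combination_def if_True)
      next
        case False
        then show ?thesis by (simp only: sum_fun_apply fun_scale_def line_vector_def row_combination_def if_False) simp
      qed
    qed
    then have "(\<Sum>J\<in>A. fun_scale (c J) (line_vector J)) = 0 \<longleftrightarrow> (\<forall>i\<in>{1..d + 1}. (\<Sum>J\<in>A. c J * V i J) = 0)" for c
      by (simp only: row_combination_eq_0_iff[OF rows_independent])
    then show ?thesis
      unfolding span fun_vs.dim_image_eq_card_iff[OF fA] fun_vs.independent_family_iff[OF fA, of line_vector]
        columns_independent_iff[OF fA] by simp
  qed
  then show ?thesis
    unfolding matroid_of_lines_def column_matroid_def by blast
qed

end

theorem theorem6:
  fixes W :: "nat \<Rightarrow> nat \<Rightarrow> 'k::alg_closed_field"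
    and X :: "(nat \<Rightarrow> 'k) set"
    and d n :: nat
  assumes "n \<ge> d + 1"
    and "fun_vs.subspace X" and "X \<subseteq> coord_space {1..n}" and "fun_vs.dim X = d + 1"
    and "X = rowspace {1..d + 1} {1..n} W"
  shows
    "let L = affine_cone (grassmannian_sub d n X);
         M = matroid_of_subspace (subsets n d) L
     in fun_vs.subspace L \<and> fun_vs.dim L = d + 1 \<and>
        is_matroid M \<and> ground M = subsets n d \<and> matroid_rank M (ground M) = d + 1 \<and>
        M = column_matroid {1..d + 1} (subsets n d) (V_mat d W) \<and>
        M = dual_matroid (column_matroid (U_rows d n) (subsets n d) (U_mat d W)) \<and>
        M = matroid_of_lines d n X (induced_arrangement X)"
proof -
  interpret full_rank_matrix d n W
    using assms(4,5) dim_rowspace_eq_card_iff[of "{1..d + 1}" "{1..n}" W]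
    by unfold_locales simp
  let ?L = "rowspace {1..d + 1} (subsets n d) (V_mat d W)"
  let ?N = "column_matroid {1..d + 1} (subsets n d) (V_mat d W)"
  have L: "affine_cone (grassmannian_sub d n X) = ?L"
    unfolding assms(5) by (rule affine_cone_grassmannian_sub)
  have M: "matroid_of_subspace (subsets n d) ?L = ?N"
    by (rule matroid_of_subspace_rowspace(1)[OF finite_atLeastAtMost finite_subsets])
  have dim: "fun_vs.dim ?L = d + 1"
    using V_rows_independent dim_rowspace_eq_card_iff[of "{1..d + 1}" "subsets n d" "V_mat d W"] by simp
  \<comment> \<open>Vanishing on the whole ground set leaves only 0, so the rank of the matroid is
    the dimension of \<open>?L\<close>.\<close>
  have "?L \<inter> {x. \<forall>e\<in>subsets n d. x e = 0} \<subseteq> fun_vs.span {}"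
  proof
    fix x assume x: "x \<in> ?L \<inter> {x. \<forall>e\<in>subsets n d. x e = 0}"
    then have "x \<in> coord_space (subsets n d)" using rowspace_subset_coord_space by blast
    then have "x = 0" using x by (auto simp: coord_space_def fun_eq_iff)
    then show "x \<in> fun_vs.span {}" by simp
  qed
  then have "fun_vs.dim (?L \<inter> {x. \<forall>e\<in>subsets n d. x e = 0}) = 0"
    using fun_vs.dim_le_card[OF _ finite.emptyI] by (simp only: card.empty le_zero_eq)
  then have "vanishing_codim ?L (subsets n d) = d + 1"
    unfolding vanishing_codim_def dim by simp
  then have "matroid_rank ?N (ground ?N) = d + 1"
    unfolding column_matroid_simps(1)
      matroid_of_subspace_rowspace(2)[OF finite_atLeastAtMost finite_subsets subset_refl] .
  moreover have "?N = dual_matroid (column_matroid (U_rows d n) (subsets n d) (U_mat d W))"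
    by (rule dual_column_matroid[OF finite_atLeastAtMost finite_subsets mem_rowspace_V_iff])
  moreover have "?N = matroid_of_lines d n X (induced_arrangement X)"
    unfolding assms(5) by (rule matroid_of_lines_eq[symmetric])
  ultimately show ?thesis
    unfolding Let_def L M
    by (intro conjI subspace_rowspace dim is_matroid_column_matroid[OF finite_subsets] column_matroid_simps(1) refl)
qed

end
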